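(* Consider the linear regression model $Y=X\theta_0+\xi$, where $X\in\mathbb{R}^{n\times d}$ is a random design matrix with i.i.d. mean-zero rows and $\xi=(\xi_1,\ldots,\xi_n)$ is a mean-zero noise vector independent of $X$ (its components need not be independent). Suppose $0<\liminf\underline\sigma_d\le\limsup\bar\sigma_d<\infty$. Suppose that $$\min_{|S|\le s}\phi(3,S)\ge c_0$$ holds for some $c_0>0$ with probability tending to $1$ as $n\to\infty$, and that for some $1/4\le\alpha\le1/2$, $$\limsup_{n\to\infty}\frac{\log d\cdot\big(M_4(X)\vee\log^2d\big)}{n^{2-4\alpha}}<\infty,$$ where $M_4(X)=\mathbb{E}\max_{1\le j\le d}|X_{1j}|^4$. Then, for $\hat\theta^L=\hat\theta\big(2L\|\boldsymbol{\xi}_n\|_{1/\alpha,1}\sqrt{\log d/n}\big)$, $$\lim_{L\to\infty}\limsup_{n\to\infty}\sup_{\theta_0\in B_0(s)}\mathbb{P}_{\theta_0}\Big(\frac1n\|X(\hat\theta^L-\theta_0)\|_2^2>\frac{16L^2\|\boldsymbol{\xi}_n\|_{1/\alpha,1}^2}{c_0^2}\cdot\frac{s\log d}{n}\Big)=0.$$ Here $\|\boldsymbol{\xi}_n\|_{1/\alpha,1}=\int_0^\infty\big(\frac1n\sum_{i=1}^n\mathbb{P}(|\xi_i|>t)\big)^\alpha\,dt$.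
   Context: The dimension $d=d_n$ and sparsity $s=s_n$ can either stay bounded or blow up to infinity as $n\to\infty$. The Lasso estimator with tuning parameter $\lambda$ is $\hat\theta(\lambda)=\arg\min_{\theta\in\mathbb{R}^d}\big(\frac1n\|Y-X\theta\|_2^2+\lambda\|\theta\|_1\big)$. For $\theta\in\mathbb{R}^d$ and $S\subset\{1,\ldots,d\}$, $\theta_S=(\theta_i\mathbf{1}_{i\in S})_i$ and $\theta_{S^c}=(\theta_i\mathbf{1}_{i\notin S})_i$. For $L>0$, $$\phi(L,S)=\sqrt{|S|}\,\min\Big\{\tfrac{1}{\sqrt n}\|X\theta_S-X\theta_{S^c}\|_2:\ \|\theta_S\|_1=1,\ \|\theta_{S^c}\|_1\le L\Big\}.$$ $B_0(s)$ is the set of $\theta\in\mathbb{R}^d$ with at most $s$ nonzero coordinates. $\Sigma=\mathbb{E}[X^\top X/n]$, and $\underline\sigma_d,\bar\sigma_d$ are its smallest and largest singular values. $a\vee b=\max\{a,b\}$. $\mathbb{P}_{\theta_0}$ denotes probability when the true parameter is $\theta_0$.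
   Formalization: The dimension is assumed to satisfy d ≥ 2 for every n; for d = 1 we have log d = 0, so the tuning parameter and the bound vanish and the claim fails (e.g. standard Gaussian design and noise). *)

theory Defs
  imports "HOL-Probability.Probability" "Jordan_Normal_Form.Char_Poly"
begin

unbundle no vec_syntax

definition l1_norm :: "real vec \<Rightarrow> real" where
  "l1_norm v = (\<Sum>i<dim_vec v. \<bar>v $ i\<bar>)"

definition l2_norm :: "real vec \<Rightarrow> real" where
  "l2_norm v = sqrt (\<Sum>i<dim_vec v. (v $ i)\<^sup>2)"

definition restrict_vec :: "nat set \<Rightarrow> real vec \<Rightarrow> real vec" where
  "restrict_vec S v = vec (dim_vec v) (\<lambda>i. if i \<in> S then v $ i else 0)"

definition sparse_vecs :: "nat \<Rightarrow> nat \<Rightarrow> real vec set" where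
  "sparse_vecs d s = {\<theta> \<in> carrier_vec d. card {j. j < d \<and> \<theta> $ j \<noteq> 0} \<le> s}"

text \<open>For a nonempty set \<open>S\<close> of column indices the feasible set is nonempty and compact, so the
  infimum below is a minimum. For empty \<open>S\<close> it is empty and the value is meaningless.\<close>

definition compatibility :: "real mat \<Rightarrow> real \<Rightarrow> nat set \<Rightarrow> real" where
  "compatibility A L S = sqrt (real (card S)) *
     Inf {1 / sqrt (real (dim_row A)) *
            l2_norm (A *\<^sub>v restrict_vec S \<theta> - A *\<^sub>v restrict_vec (- S) \<theta>) | \<theta>.
          \<theta> \<in> carrier_vec (dim_col A) \<and>
          l1_norm (restrict_vec S \<theta>) = 1 \<and> l1_norm (restrict_vec (- S) \<theta>) \<le> L}"

definition singular_values :: "real mat \<Rightarrow> real set" where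
  "singular_values A = sqrt ` {k. eigenvalue (transpose_mat A * A) k}"

text \<open>The tuning parameter \<open>l\<close> ranges over \<open>[0,\<infinity>]\<close>. For finite \<open>l\<close> this is the usual real-valued
  objective; for \<open>l = \<infinity>\<close> the convention \<open>\<infinity> * 0 = 0\<close> makes the zero vector the only minimizer.\<close>

definition lasso_objective :: "real mat \<Rightarrow> real vec \<Rightarrow> ennreal \<Rightarrow> real vec \<Rightarrow> ennreal" where
  "lasso_objective A y l \<theta> =
     ennreal (1 / real (dim_row A) * (l2_norm (y - A *\<^sub>v \<theta>))\<^sup>2) + l * ennreal (l1_norm \<theta>)"

text \<open>The minimizer need not be unique, so a Lasso estimator is any selection of minimizers.\<close>

definition lasso_estimator :: "(ennreal \<Rightarrow> real mat \<Rightarrow> real vec \<Rightarrow> real vec) \<Rightarrow> bool" where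
  "lasso_estimator est \<longleftrightarrow>
     (\<forall>l A y. dim_vec y = dim_row A \<longrightarrow>
        is_arg_min (lasso_objective A y l) (\<lambda>\<theta>. \<theta> \<in> carrier_vec (dim_col A)) (est l A y))"

text \<open>JNF vectors and matrices carry no sigma-algebra. As random elements they are identified
  with extensional functions on their index sets, with the product Borel sigma-algebra.\<close>

abbreviation coords :: "nat \<Rightarrow> real vec \<Rightarrow> nat \<Rightarrow> real" where
  "coords k v \<equiv> (\<lambda>i\<in>{..<k}. v $ i)"

abbreviation entries :: "nat \<Rightarrow> nat \<Rightarrow> real mat \<Rightarrow> nat \<times> nat \<Rightarrow> real" where
  "entries n d A \<equiv> (\<lambda>ij\<in>{..<n} \<times> {..<d}. A $$ ij)"

definition iid_rows :: "'a measure \<Rightarrow> nat \<Rightarrow> nat \<Rightarrow> ('a \<Rightarrow> real mat) \<Rightarrow> bool" where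
  "iid_rows M n d X \<longleftrightarrow>
     prob_space.indep_vars M (\<lambda>_. Pi\<^sub>M {..<d} (\<lambda>_. borel))
       (\<lambda>i \<omega>. coords d (row (X \<omega>) i)) {..<n} \<and>
     (\<forall>i<n. distr M (Pi\<^sub>M {..<d} (\<lambda>_. borel)) (\<lambda>\<omega>. coords d (row (X \<omega>) i)) =
            distr M (Pi\<^sub>M {..<d} (\<lambda>_. borel)) (\<lambda>\<omega>. coords d (row (X \<omega>) 0)))"

text \<open>The library constant \<open>indep_var\<close> forces both random elements to have the same type, so
  independence is stated through the generated sigma-algebras.\<close>

definition indep_elements ::
    "'a measure \<Rightarrow> 'b measure \<Rightarrow> ('a \<Rightarrow> 'b) \<Rightarrow> 'c measure \<Rightarrow> ('a \<Rightarrow> 'c) \<Rightarrow> bool" where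
  "indep_elements M S U T V \<longleftrightarrow>
     U \<in> measurable M S \<and> V \<in> measurable M T \<and>
     prob_space.indep_set M {U -` A \<inter> space M | A. A \<in> sets S} {V -` B \<inter> space M | B. B \<in> sets T}"

definition indep_design_noise ::
    "'a measure \<Rightarrow> nat \<Rightarrow> nat \<Rightarrow> ('a \<Rightarrow> real mat) \<Rightarrow> ('a \<Rightarrow> real vec) \<Rightarrow> bool" where
  "indep_design_noise M n d X \<xi> \<longleftrightarrow>
     indep_elements M
       (Pi\<^sub>M ({..<n} \<times> {..<d}) (\<lambda>_. borel)) (\<lambda>\<omega>. entries n d (X \<omega>))
       (Pi\<^sub>M {..<n} (\<lambda>_. borel)) (\<lambda>\<omega>. coords n (\<xi> \<omega>))"

definition mean_zero :: "'a measure \<Rightarrow> ('a \<Rightarrow> real) \<Rightarrow> bool" where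
  "mean_zero M Z \<longleftrightarrow> integrable M Z \<and> integral\<^sup>L M Z = 0"

definition gram_mean :: "'a measure \<Rightarrow> nat \<Rightarrow> nat \<Rightarrow> ('a \<Rightarrow> real mat) \<Rightarrow> real mat" where
  "gram_mean M n d X =
     mat d d (\<lambda>jk. integral\<^sup>L M (\<lambda>\<omega>. (transpose_mat (X \<omega>) * X \<omega>) $$ jk / real n))"

definition fourth_moment :: "'a measure \<Rightarrow> nat \<Rightarrow> ('a \<Rightarrow> real mat) \<Rightarrow> ennreal" where
  "fourth_moment M d X =
     (\<integral>\<^sup>+ \<omega>. ennreal (Max ((\<lambda>j. \<bar>X \<omega> $$ (0, j)\<bar> ^ 4) ` {..<d})) \<partial>M)"

definition noise_norm :: "'a measure \<Rightarrow> nat \<Rightarrow> real \<Rightarrow> ('a \<Rightarrow> real vec) \<Rightarrow> ennreal" where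
  "noise_norm M n \<alpha> \<xi> =
     (\<integral>\<^sup>+ t\<in>{0..}. ennreal ((1 / real n * (\<Sum>i<n. \<P>(\<omega> in M. \<bar>\<xi> \<omega> $ i\<bar> > t))) powr \<alpha>) \<partial>lborel)"

end

theory Submission
  imports Defs
begin

text \<open>
  Three facts give the theorem.

  (1) Deterministically, if \<open>4 \<bar>\<Sum>\<^sub>i \<xi>\<^sub>i X\<^sub>i\<^sub>j\<bar> \<le> n \<lambda>\<close> for every column \<open>j\<close>, then comparing the objective at the
  Lasso solution and at the true parameter puts the error in the cone where the compatibility
  constant is defined. If that constant is at least \<open>c\<^sub>0\<close>, this
  bounds the squared prediction error, divided by \<open>n\<close>, by \<open>4 \<lambda>\<^sup>2 s / c\<^sub>0\<^sup>2\<close>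
  (\<open>lasso_prediction_error\<close>), and for \<open>\<lambda> = 2 L N sqrt (log d / n)\<close>, where \<open>N\<close> is the noise norm, it is the
  bound claimed. So only the probability that \<open>max\<^sub>j \<bar>\<Sum>\<^sub>i \<xi>\<^sub>i X\<^sub>i\<^sub>j\<bar>\<close> exceeds
  \<open>(L / 2) N sqrt (n log d)\<close> is left to bound; by Markov's inequality it is \<open>O (1 / L)\<close> once the
  expected maximum is shown to be at most \<open>C N sqrt (n log d)\<close>.

  (2) For a fixed set \<open>I\<close> of \<open>k\<close> rows, the expectation of \<open>max\<^sub>j \<bar>\<Sum>\<^sub>i\<^sub>\<in>\<^sub>I X\<^sub>i\<^sub>j\<bar>\<close> is at most a constant
  times \<open>sqrt (log d) n\<^bsup>1/2 - \<alpha>\<^esup> k\<^bsup>\<alpha>\<^esup>\<close> (\<open>expectation_Max_abs_sum_rows_le\<close>). Rows with an entry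
  above a level \<open>\<tau>\<close> are cut off. The remaining sums have Bernstein type exponential moments and contribute
  \<open>sqrt (k v log d) + \<tau> log d\<close>; the rows that were cut off contribute \<open>k M\<^sub>4 / \<tau>\<^sup>3\<close>. The choice
  \<open>\<tau>\<^sup>4 = k M\<^sub>4 / log d\<close> balances the last two terms, and the moment condition turns them into
  \<open>sqrt (log d) k\<^bsup>1/4\<^esup> n\<^bsup>1/2 - \<alpha>\<^esup>\<close>. Since \<open>1 \<le> k \<le> n\<close> and \<open>1/4 \<le> \<alpha> \<le> 1/2\<close>, both \<open>k\<^bsup>1/4\<^esup> n\<^bsup>1/2 - \<alpha>\<^esup>\<close> and
  \<open>k\<^bsup>1/2\<^esup>\<close> are at most \<open>k\<^bsup>\<alpha>\<^esup> n\<^bsup>1/2 - \<alpha>\<^esup>\<close>. Here \<open>v\<close> bounds the second moments of the entries, which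
  are diagonal entries of the mean Gram matrix and hence at most its largest singular value
  (\<open>diagonal_le_Max_singular_value\<close>).

  (3) The noise enters through its level sets (\<open>multiplier_inequality\<close>): \<open>\<xi>\<^sub>i\<close> is the integral over \<open>t \<ge> 0\<close> of the
  indicator of \<open>\<xi>\<^sub>i > t\<close> minus that of \<open>- \<xi>\<^sub>i > t\<close>, so the weighted sum of rows is an integral of
  sums over random index sets that are independent of the design. By (2) such a sum costs the
  \<open>\<alpha>\<close>-th power of the size of the set. Concavity moves the expectation inside that power and leaves at most
  the expected number of \<open>i\<close> with \<open>\<bar>\<xi>\<^sub>i\<bar> > t\<close>, and the integral over \<open>t\<close> is \<open>n\<^bsup>\<alpha>\<^esup> N\<close>.
\<close>

unbundle no inner_syntax

section \<open>The Lasso on the event of small noise correlation\<close>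

text \<open>The hypothesis on the noise says that twice the correlation of the noise with a column,
  divided by \<open>n\<close>, is at most half the tuning parameter. Half of the penalty thus absorbs the noise,
  and the other half forces the error off the support to have at most three times the \<open>\<ell>\<^sub>1\<close> mass that it has on
  the support. For \<open>l = 0\<close> no cone condition follows, but then the noise is orthogonal to all columns and
  the prediction error vanishes.\<close>

lemma lasso_prediction_error:
  fixes A :: "real mat" and \<theta> u e :: "real vec" and l c :: real
  assumes A: "A \<in> carrier_mat n d" and \<theta>: "\<theta> \<in> carrier_vec d" and u: "u \<in> carrier_vec d"
    and e: "e \<in> carrier_vec n" and n: "n > 0" and l: "l \<ge> 0" and c: "c > 0"
    and min: "1 / real n * (l2_norm (A *\<^sub>v \<theta> + e - A *\<^sub>v u))\<^sup>2 + l * l1_norm u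
            \<le> 1 / real n * (l2_norm (A *\<^sub>v \<theta> + e - A *\<^sub>v \<theta>))\<^sup>2 + l * l1_norm \<theta>"
    and noise: "\<And>j. j < d \<Longrightarrow> 4 * \<bar>\<Sum>i<n. e $ i * A $$ (i, j)\<bar> \<le> real n * l"
    and S: "S = {j. j < d \<and> \<theta> $ j \<noteq> 0}"
    and compat: "S \<noteq> {} \<Longrightarrow> c \<le> compatibility A 3 S"
  shows "1 / real n * (l2_norm (A *\<^sub>v (u - \<theta>)))\<^sup>2 \<le> 4 * l\<^sup>2 * real (card S) / c\<^sup>2"
proof -
  define a where "a i = (A *\<^sub>v (u - \<theta>)) $ i" for i
  define \<delta> where "\<delta> j = u $ j - \<theta> $ j" for j
  define W where "W = (\<Sum>i<n. (a i)\<^sup>2)"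
  define P where "P = (\<Sum>j\<in>S. \<bar>\<delta> j\<bar>)"
  define Q where "Q = (\<Sum>j\<in>{..<d} - S. \<bar>\<delta> j\<bar>)"
  have SD: "S \<subseteq> {..<d}" "finite S" using S by auto
  have fit: "A *\<^sub>v (u - \<theta>) \<in> carrier_vec n" using A u \<theta> by simp
  have a_sum: "a i = (\<Sum>j<d. A $$ (i, j) * \<delta> j)" if "i < n" for i
    using A u \<theta> that by (simp add: a_def \<delta>_def scalar_prod_def lessThan_atLeast0)
  have W_norm: "(l2_norm (A *\<^sub>v (u - \<theta>)))\<^sup>2 = W" "l2_norm (A *\<^sub>v (u - \<theta>)) = sqrt W"
    using fit A by (auto simp: l2_norm_def W_def a_def sum_nonneg)
  have W0: "W \<ge> 0" "P \<ge> 0" "Q \<ge> 0" by (auto simp: W_def P_def Q_def sum_nonneg)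
  have Au: "A *\<^sub>v u = A *\<^sub>v (u - \<theta>) + A *\<^sub>v \<theta>"
  proof -
    have "u = (u - \<theta>) + \<theta>" using u \<theta> by (intro eq_vecI) auto
    then show ?thesis using mult_add_distrib_mat_vec[OF A, of "u - \<theta>" \<theta>] u \<theta> by simp
  qed
  have res: "(A *\<^sub>v \<theta> + e - A *\<^sub>v u) $ i = e $ i - a i" if "i < n" for i
    using fit A e that by (subst Au) (simp add: a_def del: index_mult_mat_vec)
  have l2u: "(l2_norm (A *\<^sub>v \<theta> + e - A *\<^sub>v u))\<^sup>2 = (\<Sum>i<n. (e $ i - a i)\<^sup>2)"
    using A res by (auto simp: l2_norm_def sum_nonneg intro!: sum.cong)
  have l2t: "(l2_norm (A *\<^sub>v \<theta> + e - A *\<^sub>v \<theta>))\<^sup>2 = (\<Sum>i<n. (e $ i)\<^sup>2)"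
    using A e by (auto simp: l2_norm_def sum_nonneg intro!: sum.cong)
  have l1: "l1_norm u = (\<Sum>j<d. \<bar>u $ j\<bar>)" "l1_norm \<theta> = (\<Sum>j<d. \<bar>\<theta> $ j\<bar>)"
    using u \<theta> by (auto simp: l1_norm_def)
  have sq: "(\<Sum>i<n. (e $ i - a i)\<^sup>2) = (\<Sum>i<n. (e $ i)\<^sup>2) - 2 * (\<Sum>i<n. e $ i * a i) + W"
    by (simp add: power2_diff sum.distrib sum_subtractf W_def sum_distrib_left mult.assoc)
  \<comment> \<open>Hoelder's inequality between the noise correlations and the coordinates of the error.\<close>
  have "(\<Sum>i<n. e $ i * a i) = (\<Sum>i<n. \<Sum>j<d. e $ i * (A $$ (i, j) * \<delta> j))"
    by (intro sum.cong) (auto simp: a_sum sum_distrib_left)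
  also have "\<dots> = (\<Sum>j<d. \<delta> j * (\<Sum>i<n. e $ i * A $$ (i, j)))"
    by (subst sum.swap) (simp add: sum_distrib_left mult_ac)
  also have "\<dots> \<le> (\<Sum>j<d. \<bar>\<delta> j\<bar> * (real n * l / 4))"
  proof (rule sum_mono)
    fix j assume "j \<in> {..<d}"
    then have "\<bar>\<Sum>i<n. e $ i * A $$ (i, j)\<bar> \<le> real n * l / 4" using noise[of j] by simp
    then have "\<bar>\<delta> j\<bar> * \<bar>\<Sum>i<n. e $ i * A $$ (i, j)\<bar> \<le> \<bar>\<delta> j\<bar> * (real n * l / 4)"
      by (intro mult_left_mono) auto
    then show "\<delta> j * (\<Sum>i<n. e $ i * A $$ (i, j)) \<le> \<bar>\<delta> j\<bar> * (real n * l / 4)"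
      using abs_ge_self[of "\<delta> j * (\<Sum>i<n. e $ i * A $$ (i, j))"] by (simp add: abs_mult)
  qed
  also have "\<dots> = real n * l / 4 * (P + Q)"
    unfolding sum_distrib_right[symmetric] P_def Q_def
    using sum.subset_diff[OF SD(1), of "\<lambda>j. \<bar>\<delta> j\<bar>"] by (simp add: algebra_simps)
  finally have cross: "(\<Sum>i<n. e $ i * a i) \<le> real n * l / 4 * (P + Q)" .
  have "(\<Sum>j<d. \<bar>\<theta> $ j\<bar> - \<bar>u $ j\<bar>) =
      (\<Sum>j\<in>{..<d} - S. \<bar>\<theta> $ j\<bar> - \<bar>u $ j\<bar>) + (\<Sum>j\<in>S. \<bar>\<theta> $ j\<bar> - \<bar>u $ j\<bar>)"
    using sum.subset_diff[OF SD(1), of "\<lambda>j. \<bar>\<theta> $ j\<bar> - \<bar>u $ j\<bar>"] by simp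
  also have "(\<Sum>j\<in>{..<d} - S. \<bar>\<theta> $ j\<bar> - \<bar>u $ j\<bar>) = - Q"
    unfolding Q_def sum_negf[symmetric] by (rule sum.cong) (auto simp: S \<delta>_def)
  also have "(\<Sum>j\<in>S. \<bar>\<theta> $ j\<bar> - \<bar>u $ j\<bar>) \<le> P"
    unfolding P_def by (rule sum_mono) (auto simp: \<delta>_def)
  finally have pen: "l1_norm \<theta> - l1_norm u \<le> P - Q" by (simp add: l1 sum_subtractf)
  have "W \<le> 2 * (\<Sum>i<n. e $ i * a i) + real n * l * (l1_norm \<theta> - l1_norm u)"
    using mult_left_mono[OF min, of "real n"] n unfolding l2u l2t sq by (simp add: algebra_simps)
  also have "\<dots> \<le> 2 * (real n * l / 4 * (P + Q)) + real n * l * (P - Q)"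
    using cross pen l by (intro add_mono mult_left_mono) auto
  also have "\<dots> = real n * l * (3 / 2 * P - 1 / 2 * Q)" by (simp add: field_simps)
  finally have basic: "W \<le> real n * l * (3 / 2 * P - 1 / 2 * Q)" .
  show ?thesis
  proof (cases "l = 0 \<or> P = 0")
    case True
    have "real n * l * (3 / 2 * P - 1 / 2 * Q) \<le> 0"
      using True l W0 by (auto simp: mult_nonneg_nonpos)
    then have "W = 0" using basic W0 by linarith
    then show ?thesis by (simp add: W_norm)
  next
    case False
    then have l0: "l > 0" and P0: "P > 0" using l W0 by auto
    have "0 \<le> real n * l * (3 / 2 * P - 1 / 2 * Q)" using basic W0 by linarith
    then have "0 \<le> 3 / 2 * P - 1 / 2 * Q"
      using mult_le_cancel_left_pos[of "real n * l" 0 "3 / 2 * P - 1 / 2 * Q"] l0 n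
      by (simp only: mult_zero_right) simp
    then have QP: "Q \<le> 3 * P" by simp
    have Sne: "S \<noteq> {}" using P0 by (auto simp: P_def)
    \<comment> \<open>The compatibility constant has a minus sign between the two blocks, so the test
      vector is the error with its block outside the support reflected.\<close>
    define v where "v = vec d (\<lambda>j. if j \<in> S then \<delta> j / P else - \<delta> j / P)"
    have v: "v \<in> carrier_vec d" by (simp add: v_def)
    have "l1_norm (restrict_vec S v) = (\<Sum>j<d. if j \<in> S then \<bar>\<delta> j\<bar> / P else 0)"
      unfolding l1_norm_def restrict_vec_def v_def using P0 by (auto intro!: sum.cong)
    also have "\<dots> = (\<Sum>j\<in>S. \<bar>\<delta> j\<bar> / P)"
      using SD(1) by (simp add: sum.If_cases Int_absorb1)
    finally have v1: "l1_norm (restrict_vec S v) = 1"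
      using P0 by (simp add: sum_divide_distrib[symmetric] P_def[symmetric])
    have "l1_norm (restrict_vec (- S) v) = (\<Sum>j<d. if j \<in> S then 0 else \<bar>\<delta> j\<bar> / P)"
      unfolding l1_norm_def restrict_vec_def v_def using P0 by (auto intro!: sum.cong)
    also have "\<dots> = (\<Sum>j\<in>{..<d} - S. \<bar>\<delta> j\<bar> / P)"
      by (simp add: sum.If_cases Diff_eq)
    finally have v2: "l1_norm (restrict_vec (- S) v) \<le> 3"
      using P0 QP by (simp add: sum_divide_distrib[symmetric] Q_def[symmetric] divide_le_eq)
    have Av: "A *\<^sub>v restrict_vec S v - A *\<^sub>v restrict_vec (- S) v = (1 / P) \<cdot>\<^sub>v (A *\<^sub>v (u - \<theta>))"
    proof (rule eq_vecI)
      fix i assume "i < dim_vec ((1 / P) \<cdot>\<^sub>v (A *\<^sub>v (u - \<theta>)))"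
      then have i: "i < n" using A by simp
      have "(A *\<^sub>v restrict_vec S v - A *\<^sub>v restrict_vec (- S) v) $ i
          = (\<Sum>j<d. A $$ (i, j) * restrict_vec S v $ j - A $$ (i, j) * restrict_vec (- S) v $ j)"
        using A i by (simp add: scalar_prod_def lessThan_atLeast0 restrict_vec_def v_def sum_subtractf)
      also have "\<dots> = (\<Sum>j<d. A $$ (i, j) * \<delta> j / P)"
        by (rule sum.cong) (auto simp: restrict_vec_def v_def)
      also have "\<dots> = a i / P" using i by (simp add: a_sum sum_divide_distrib)
      finally show "(A *\<^sub>v restrict_vec S v - A *\<^sub>v restrict_vec (- S) v) $ i
          = ((1 / P) \<cdot>\<^sub>v (A *\<^sub>v (u - \<theta>))) $ i"
        using A i by (simp add: a_def)
    qed (use A in simp)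
    have "l2_norm ((1 / P) \<cdot>\<^sub>v (A *\<^sub>v (u - \<theta>))) = sqrt (\<Sum>i<n. (a i / P)\<^sup>2)"
      using A by (auto simp: l2_norm_def a_def intro!: sum.cong)
    also have "\<dots> = sqrt W / P"
      using P0 by (simp add: power_divide sum_divide_distrib[symmetric] W_def real_sqrt_divide)
    finally have l2v: "l2_norm ((1 / P) \<cdot>\<^sub>v (A *\<^sub>v (u - \<theta>))) = sqrt W / P" .
    have "c \<le> sqrt (real (card S)) * (1 / sqrt (real n) * (sqrt W / P))"
    proof -
      have "c \<le> compatibility A 3 S" by (rule compat[OF Sne])
      also have "\<dots> \<le> sqrt (real (card S)) * (1 / sqrt (real n) * (sqrt W / P))"
        unfolding compatibility_def
      proof (rule mult_left_mono[OF cInf_lower])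
        show "1 / sqrt (real n) * (sqrt W / P) \<in> {1 / sqrt (real (dim_row A)) *
            l2_norm (A *\<^sub>v restrict_vec S \<theta> - A *\<^sub>v restrict_vec (- S) \<theta>) | \<theta>.
          \<theta> \<in> carrier_vec (dim_col A) \<and>
          l1_norm (restrict_vec S \<theta>) = 1 \<and> l1_norm (restrict_vec (- S) \<theta>) \<le> 3}"
          using A v v1 v2 Av l2v by (intro CollectI exI[of _ v]) auto
        show "bdd_below {1 / sqrt (real (dim_row A)) *
            l2_norm (A *\<^sub>v restrict_vec S \<theta> - A *\<^sub>v restrict_vec (- S) \<theta>) | \<theta>.
          \<theta> \<in> carrier_vec (dim_col A) \<and>
          l1_norm (restrict_vec S \<theta>) = 1 \<and> l1_norm (restrict_vec (- S) \<theta>) \<le> 3}"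
          by (intro bdd_belowI[of _ 0]) (auto simp: l2_norm_def sum_nonneg)
      qed simp
      finally show ?thesis .
    qed
    then have cP: "c * P * sqrt (real n) \<le> sqrt (real (card S)) * sqrt W"
      using P0 n by (simp add: field_simps)
    have W32: "W \<le> real n * l * (3 / 2 * P)"
    proof -
      have "real n * l * (3 / 2 * P - 1 / 2 * Q) \<le> real n * l * (3 / 2 * P)"
        using l W0 by (intro mult_left_mono) auto
      then show ?thesis using basic by linarith
    qed
    have "c * sqrt W \<le> 3 / 2 * l * sqrt (real n) * sqrt (real (card S))"
    proof (cases "W = 0")
      case False
      then have "sqrt W > 0" using W0 by simp
      have root: "real n = sqrt (real n) * sqrt (real n)" by simp
      have "c * sqrt W * sqrt W \<le> c * (real n * l * (3 / 2 * P))"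
        using mult_left_mono[OF W32, of c] c W0 by (simp add: mult.assoc)
      also have "\<dots> = 3 / 2 * l * sqrt (real n) * (c * P * sqrt (real n))"
        by (subst root) (simp only: mult_ac)
      also have "\<dots> \<le> 3 / 2 * l * sqrt (real n) * (sqrt (real (card S)) * sqrt W)"
        using cP l by (intro mult_left_mono) auto
      finally show ?thesis using \<open>sqrt W > 0\<close> by (simp add: mult.assoc[symmetric])
    qed (use l in simp)
    then have "(c * sqrt W)\<^sup>2 \<le> (3 / 2 * l * sqrt (real n) * sqrt (real (card S)))\<^sup>2"
      using c W0 by (intro power_mono) auto
    then have "c\<^sup>2 * W \<le> 9 / 4 * (l\<^sup>2 * real n * real (card S))"
      using W0 by (simp add: power_mult_distrib power_divide)
    also have "\<dots> \<le> 4 * (l\<^sup>2 * real n * real (card S))" by (intro mult_right_mono) auto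
    finally show ?thesis using c n by (simp add: W_norm(1) field_simps)
  qed
qed

section \<open>Diagonal entries and the largest singular value\<close>

lemma mult_mat_vec_norm_bound:
  fixes A :: "real mat"
  assumes A: "A \<in> carrier_mat n d"
  shows "\<exists>K>0. \<forall>x\<in>carrier_vec d. (A *\<^sub>v x) \<bullet> (A *\<^sub>v x) \<le> K * (x \<bullet> x)"
proof (intro exI[of _ "1 + (\<Sum>i<n. \<Sum>j<d. (A $$ (i, j))\<^sup>2)"] conjI ballI)
  let ?F = "\<Sum>i<n. \<Sum>j<d. (A $$ (i, j))\<^sup>2"
  show "0 < 1 + ?F" by (intro add_pos_nonneg sum_nonneg) auto
  fix x :: "real vec" assume x: "x \<in> carrier_vec d"
  have xx: "x \<bullet> x = (\<Sum>j<d. (x $ j)\<^sup>2)"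
    using x by (simp add: scalar_prod_def lessThan_atLeast0 power2_eq_square)
  have "(A *\<^sub>v x) \<bullet> (A *\<^sub>v x) = (\<Sum>i<n. (\<Sum>j<d. A $$ (i, j) * x $ j)\<^sup>2)"
    using A x by (simp add: scalar_prod_def lessThan_atLeast0 power2_eq_square)
  also have "\<dots> \<le> (\<Sum>i<n. (\<Sum>j<d. (A $$ (i, j))\<^sup>2) * (\<Sum>j<d. (x $ j)\<^sup>2))"
    by (intro sum_mono Cauchy_Schwarz_ineq_sum)
  also have "\<dots> = ?F * (x \<bullet> x)" by (simp add: xx sum_distrib_right)
  also have "\<dots> \<le> (1 + ?F) * (x \<bullet> x)" by (simp add: xx sum_nonneg algebra_simps)
  finally show "(A *\<^sub>v x) \<bullet> (A *\<^sub>v x) \<le> (1 + ?F) * (x \<bullet> x)" .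
qed

lemma finite_singular_values:
  assumes "A \<in> carrier_mat d d" shows "finite (singular_values A)"
proof -
  have B: "transpose_mat A * A \<in> carrier_mat d d" using assms by simp
  have "char_poly (transpose_mat A * A) \<noteq> 0"
    using degree_monic_char_poly[OF B] by auto
  then have "finite {k. poly (char_poly (transpose_mat A * A)) k = 0}" by (rule poly_roots_finite)
  then show ?thesis by (simp add: singular_values_def eigenvalue_root_char_poly[OF B])
qed

lemma scalar_prod_self_nonneg: "(x :: real vec) \<bullet> x \<ge> 0"
  by (simp add: scalar_prod_def sum_nonneg)

lemma scalar_prod_self_pos:
  assumes "(x :: real vec) \<in> carrier_vec d" "x \<noteq> 0\<^sub>v d" shows "x \<bullet> x > 0"
proof -
  obtain i where "i < d" "x $ i \<noteq> 0" using assms by (metis carrier_vecD eq_vecI index_zero_vec)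
  then show ?thesis using assms(1)
    by (auto simp: scalar_prod_def zero_less_mult_iff linorder_neq_iff intro!: sum_pos2[of _ i])
qed

text \<open>The squared operator norm \<open>l\<close> of \<open>A\<close> is an eigenvalue of \<open>B = A\<^sup>T A\<close>. Let \<open>l\<close> be the least
  constant with \<open>\<bar>A x\<bar>\<^sup>2 \<le> l \<bar>x\<bar>\<^sup>2\<close> for all \<open>x\<close>; then \<open>C = l I - B\<close> is positive semidefinite. If \<open>l\<close> were
  not an eigenvalue, \<open>C\<close> would be invertible, and an invertible positive semidefinite form is
  bounded below by a positive multiple of \<open>\<bar>x\<bar>\<^sup>2\<close>, so \<open>l\<close> could be lowered. This replaces the
  compactness of the sphere by linear algebra.\<close>

lemma operator_norm_eigenvalue:
  fixes A :: "real mat"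
  assumes A: "A \<in> carrier_mat d d" and d: "d > 0"
  shows "\<exists>l. eigenvalue (transpose_mat A * A) l \<and>
             (\<forall>x\<in>carrier_vec d. (A *\<^sub>v x) \<bullet> (A *\<^sub>v x) \<le> l * (x \<bullet> x))"
proof -
  define B where "B = transpose_mat A * A"
  have B: "B \<in> carrier_mat d d" using A by (simp add: B_def)
  define G where "G = {l. \<forall>x\<in>carrier_vec d. (A *\<^sub>v x) \<bullet> (A *\<^sub>v x) \<le> l * (x \<bullet> x)}"
  obtain K where "K \<in> G" using mult_mat_vec_norm_bound[OF A] unfolding G_def by blast
  have G0: "l \<ge> 0" if "l \<in> G" for l
  proof -
    have "(A *\<^sub>v unit_vec d 0) \<bullet> (A *\<^sub>v unit_vec d 0) \<le> l * (unit_vec d 0 \<bullet> unit_vec d 0)"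
      using that by (auto simp: G_def)
    then show ?thesis using scalar_prod_self_nonneg[of "A *\<^sub>v unit_vec d 0"] d by simp
  qed
  have bdd: "bdd_below G" by (rule bdd_belowI[OF G0])
  define l where "l = Inf G"
  have l0: "l \<ge> 0" unfolding l_def using \<open>K \<in> G\<close> G0 by (intro cInf_greatest) auto
  have lG: "l \<in> G" unfolding G_def
  proof (intro CollectI ballI)
    fix x :: "real vec" assume x: "x \<in> carrier_vec d"
    show "(A *\<^sub>v x) \<bullet> (A *\<^sub>v x) \<le> l * (x \<bullet> x)"
    proof (cases "x = 0\<^sub>v d")
      case True
      then have "A *\<^sub>v x = 0\<^sub>v d" using A by (intro eq_vecI) auto
      then show ?thesis using True by simp
    next
      case False
      then have xx: "x \<bullet> x > 0" using x by (rule scalar_prod_self_pos[rotated])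
      have "(A *\<^sub>v x) \<bullet> (A *\<^sub>v x) / (x \<bullet> x) \<le> l" unfolding l_def
        using \<open>K \<in> G\<close> x xx by (intro cInf_greatest) (auto simp: G_def field_simps)
      then show ?thesis using xx by (simp add: field_simps)
    qed
  qed
  have "eigenvalue B l"
  proof (rule ccontr)
    assume "\<not> eigenvalue B l"
    then have "det (char_matrix B l) \<noteq> 0" using eigenvalue_det[OF B] by simp
    then obtain D where D: "D \<in> carrier_mat d d" "D * char_matrix B l = 1\<^sub>m d"
      using det_non_zero_imp_unit[OF char_matrix_closed[OF B], of l]
      unfolding Units_def by (auto simp: ring_mat_simps)
    define C where "C x = l \<cdot>\<^sub>v x - B *\<^sub>v x" for x :: "real vec"
    have C: "C x \<in> carrier_vec d" if "x \<in> carrier_vec d" for x using that B by (simp add: C_def)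
    have DC: "D *\<^sub>v (- C x) = x" if x: "x \<in> carrier_vec d" for x
    proof -
      have "char_matrix B l *\<^sub>v x = B *\<^sub>v x + (- l) \<cdot>\<^sub>v x" unfolding char_matrix_def
        by (rule eq_vecI, insert x B, auto simp: add_scalar_prod_distrib[of _ d])
      also have "\<dots> = - C x" unfolding C_def by (rule eq_vecI, insert x B, auto)
      finally have "- C x = char_matrix B l *\<^sub>v x" by simp
      then have "D *\<^sub>v (- C x) = (D * char_matrix B l) *\<^sub>v x"
        using assoc_mult_mat_vec[OF D(1) char_matrix_closed[OF B] x] by simp
      then show ?thesis using D x by simp
    qed
    have xBy: "y \<bullet> (B *\<^sub>v x) = (A *\<^sub>v y) \<bullet> (A *\<^sub>v x)" if "x \<in> carrier_vec d" "y \<in> carrier_vec d" for x y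
    proof -
      have Ax: "A *\<^sub>v x \<in> carrier_vec d" and Ay: "A *\<^sub>v y \<in> carrier_vec d" using that A by auto
      have "B *\<^sub>v x = transpose_mat A *\<^sub>v (A *\<^sub>v x)"
        using that A by (simp add: B_def assoc_mult_mat_vec[of _ d d _ d])
      then have "y \<bullet> (B *\<^sub>v x) = (transpose_mat A *\<^sub>v (A *\<^sub>v x)) \<bullet> y"
        using that A Ax by (simp only:) (rule comm_scalar_prod[of _ d], auto)
      also have "\<dots> = (A *\<^sub>v x) \<bullet> (A *\<^sub>v y)" by (rule transpose_vec_mult_scalar[OF A that(2) Ax])
      also have "\<dots> = (A *\<^sub>v y) \<bullet> (A *\<^sub>v x)" by (rule comm_scalar_prod[OF Ax Ay])
      finally show ?thesis .
    qed
    have xCy: "y \<bullet> C x = l * (y \<bullet> x) - (A *\<^sub>v y) \<bullet> (A *\<^sub>v x)"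
      if "x \<in> carrier_vec d" "y \<in> carrier_vec d" for x y
      using that B xBy[OF that] by (simp add: C_def scalar_prod_minus_distrib[of _ d])
    obtain K where K: "K > 0" "\<And>x. x \<in> carrier_vec d \<Longrightarrow> (D *\<^sub>v x) \<bullet> (D *\<^sub>v x) \<le> K * (x \<bullet> x)"
      using mult_mat_vec_norm_bound[OF D(1)] by blast
    define \<kappa> where "\<kappa> = 1 / (K * (l + 1))"
    have \<kappa>: "\<kappa> > 0" using K l0 by (simp add: \<kappa>_def)
    have "l - \<kappa> \<in> G" unfolding G_def
    proof (intro CollectI ballI)
      fix x :: "real vec" assume x: "x \<in> carrier_vec d"
      let ?y = "C x"
      have y: "?y \<in> carrier_vec d" using C x .
      \<comment> \<open>Positive semidefiniteness at \<open>x - \<epsilon> C x\<close> gives \<open>\<epsilon> \<bar>C x\<bar>\<^sup>2 \<le> x \<bullet> C x\<close> for this \<open>\<epsilon>\<close>, because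
        \<open>C \<le> (l + 1) I\<close>. The shift by 1 keeps \<open>\<epsilon>\<close> defined when \<open>l = 0\<close>.\<close>
      define \<epsilon> where "\<epsilon> = 1 / (l + 1)"
      have e: "\<epsilon> > 0" "\<epsilon> * (l + 1) = 1" using l0 by (auto simp: \<epsilon>_def)
      define z where "z = x - \<epsilon> \<cdot>\<^sub>v ?y"
      have z: "z \<in> carrier_vec d" using x y by (simp add: z_def)
      have "0 \<le> l * (z \<bullet> z) - (A *\<^sub>v z) \<bullet> (A *\<^sub>v z)" using lG z by (simp add: G_def)
      also have "z \<bullet> z = x \<bullet> x - 2 * \<epsilon> * (?y \<bullet> x) + \<epsilon>\<^sup>2 * (?y \<bullet> ?y)"
        using x y by (simp add: z_def scalar_prod_minus_distrib[of _ d] minus_scalar_prod_distrib[of _ d]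
           comm_scalar_prod[of x d ?y] power2_eq_square algebra_simps)
      also have "A *\<^sub>v z = A *\<^sub>v x - \<epsilon> \<cdot>\<^sub>v (A *\<^sub>v ?y)"
        using A x y by (simp add: z_def mult_minus_distrib_mat_vec mult_mat_vec)
      also have "(A *\<^sub>v x - \<epsilon> \<cdot>\<^sub>v (A *\<^sub>v ?y)) \<bullet> (A *\<^sub>v x - \<epsilon> \<cdot>\<^sub>v (A *\<^sub>v ?y))
          = (A *\<^sub>v x) \<bullet> (A *\<^sub>v x) - 2 * \<epsilon> * ((A *\<^sub>v ?y) \<bullet> (A *\<^sub>v x)) + \<epsilon>\<^sup>2 * ((A *\<^sub>v ?y) \<bullet> (A *\<^sub>v ?y))"
        using A x y by (simp add: scalar_prod_minus_distrib[of _ d] minus_scalar_prod_distrib[of _ d]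
           comm_scalar_prod[of "A *\<^sub>v x" d "A *\<^sub>v ?y"] power2_eq_square algebra_simps)
      finally have "0 \<le> l * (x \<bullet> x) - (A *\<^sub>v x) \<bullet> (A *\<^sub>v x) - 2 * \<epsilon> * (?y \<bullet> C x)
           + \<epsilon>\<^sup>2 * (l * (?y \<bullet> ?y) - (A *\<^sub>v ?y) \<bullet> (A *\<^sub>v ?y))"
        unfolding xCy[OF x y] by (simp add: algebra_simps)
      also have "\<epsilon>\<^sup>2 * (l * (?y \<bullet> ?y) - (A *\<^sub>v ?y) \<bullet> (A *\<^sub>v ?y)) \<le> \<epsilon>\<^sup>2 * ((l + 1) * (?y \<bullet> ?y))"
        using scalar_prod_self_nonneg[of "A *\<^sub>v ?y"] scalar_prod_self_nonneg[of ?y]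
        by (intro mult_left_mono) (auto simp: algebra_simps simp del: index_mult_mat_vec)
      also have "\<epsilon>\<^sup>2 * ((l + 1) * (?y \<bullet> ?y)) = \<epsilon> * (?y \<bullet> ?y)"
        using e(2) by (simp add: power2_eq_square mult.assoc[symmetric]) 
      finally have "\<epsilon> * (?y \<bullet> ?y) \<le> l * (x \<bullet> x) - (A *\<^sub>v x) \<bullet> (A *\<^sub>v x)" by simp
      moreover have "x \<bullet> x \<le> K * (?y \<bullet> ?y)"
        using K(2)[of "- ?y"] DC[OF x] y by simp
      then have "\<kappa> * (x \<bullet> x) \<le> \<kappa> * (K * (?y \<bullet> ?y))" using \<kappa> by (intro mult_left_mono) auto
      then have "\<kappa> * (x \<bullet> x) \<le> \<epsilon> * (?y \<bullet> ?y)" using K(1) by (simp add: \<kappa>_def \<epsilon>_def)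
      ultimately show "(A *\<^sub>v x) \<bullet> (A *\<^sub>v x) \<le> (l - \<kappa>) * (x \<bullet> x)" by (simp add: algebra_simps)
    qed
    then have "l \<le> l - \<kappa>" unfolding l_def by (rule cInf_lower[OF _ bdd])
    then show False using \<kappa> by simp
  qed
  then show ?thesis using lG unfolding G_def B_def by blast
qed

text \<open>The diagonal entry is at most the norm of its column, which is the image of a unit vector.\<close>

lemma diagonal_le_Max_singular_value:
  fixes A :: "real mat"
  assumes A: "A \<in> carrier_mat d d" and j: "j < d"
  shows "A $$ (j, j) \<le> Max (singular_values A)"
proof -
  obtain l where l: "eigenvalue (transpose_mat A * A) l"
    and bound: "\<And>x. x \<in> carrier_vec d \<Longrightarrow> (A *\<^sub>v x) \<bullet> (A *\<^sub>v x) \<le> l * (x \<bullet> x)"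
    using operator_norm_eigenvalue[OF A] j by auto
  have "(A $$ (j, j))\<^sup>2 \<le> (\<Sum>i<d. (A $$ (i, j))\<^sup>2)"
    using j by (intro member_le_sum) auto
  also have "\<dots> = (A *\<^sub>v unit_vec d j) \<bullet> (A *\<^sub>v unit_vec d j)"
    using A j by (simp add: scalar_prod_def[of "A *\<^sub>v unit_vec d j"] lessThan_atLeast0 power2_eq_square)
  also have "\<dots> \<le> l" using bound[of "unit_vec d j"] j by simp
  finally have "A $$ (j, j) \<le> sqrt l" by (rule real_le_rsqrt)
  also have "\<dots> \<le> Max (singular_values A)"
    using l by (intro Max_ge finite_singular_values[OF A]) (auto simp: singular_values_def)
  finally show ?thesis .
qed

section \<open>Maximal inequalities for sums over the rows\<close>

lemma exp_le_quadratic: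
  fixes x :: real
  assumes "\<bar>x\<bar> \<le> 1" shows "exp x \<le> 1 + x + x\<^sup>2"
proof (cases "x \<ge> 0")
  case True then show ?thesis using exp_bound[of x] assms by simp
next
  case False
  \<comment> \<open>For negative arguments the bound is that of the reciprocal of exp at the opposite point.\<close>
  define y where "y = - x"
  have y: "0 < y" "y \<le> 1" using False assms by (auto simp: y_def)
  have e: "1 + y + y\<^sup>2 / 2 \<le> exp y" using y by (intro exp_lower_Taylor_quadratic) simp
  have "1 \<le> (1 - y + y\<^sup>2) * (1 + y + y\<^sup>2 / 2)"
  proof -
    have "(1 - y + y\<^sup>2) * (1 + y + y\<^sup>2 / 2) = 1 + y\<^sup>2 / 2 + y ^ 3 / 2 + y ^ 4 / 2"
      by (simp add: power2_eq_square power3_eq_cube power4_eq_xxxx field_simps)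
    then show ?thesis using y by simp
  qed
  also have "\<dots> \<le> (1 - y + y\<^sup>2) * exp y"
    using y e by (intro mult_left_mono) auto
  finally have "1 * exp (- y) \<le> (1 - y + y\<^sup>2) * exp y * exp (- y)"
    by (intro mult_right_mono) auto
  then have "exp (- y) \<le> 1 - y + y\<^sup>2" by (simp add: mult.assoc exp_minus)
  then show ?thesis by (simp add: y_def)
qed

context prob_space
begin

text \<open>The mean is only bounded, not zero: truncating a centred variable shifts its mean a little, and
  keeping the shift in the exponent avoids centring again.\<close>

lemma mgf_bounded_le:
  fixes Y :: "'a \<Rightarrow> real"
  assumes Y [measurable]: "random_variable borel Y" and bounded: "\<And>\<omega>. \<bar>Y \<omega>\<bar> \<le> \<tau>"
    and mean: "\<bar>expectation Y\<bar> \<le> m" and var: "expectation (\<lambda>\<omega>. (Y \<omega>)\<^sup>2) \<le> v"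
    and l: "\<bar>l\<bar> * \<tau> \<le> 1"
  shows "expectation (\<lambda>\<omega>. exp (l * Y \<omega>)) \<le> exp (\<bar>l\<bar> * m + l\<^sup>2 * v)"
proof -
  have lY: "\<bar>l * Y \<omega>\<bar> \<le> 1" for \<omega>
    using mult_left_mono[OF bounded[of \<omega>], of "\<bar>l\<bar>"] l by (simp add: abs_mult)
  have int: "integrable M Y" "integrable M (\<lambda>\<omega>. (Y \<omega>)\<^sup>2)"
    using bounded power_mono[OF bounded, of _ 2]
    by (intro integrable_const_bound[of Y \<tau>] integrable_const_bound[of _ "\<tau>\<^sup>2"]; simp)+
  have "integrable M (\<lambda>\<omega>. exp (l * Y \<omega>))"
    using lY by (intro integrable_const_bound[of _ "exp 1"]) (auto intro: order_trans[OF abs_ge_self])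
  then have "expectation (\<lambda>\<omega>. exp (l * Y \<omega>)) \<le> expectation (\<lambda>\<omega>. 1 + l * Y \<omega> + l\<^sup>2 * (Y \<omega>)\<^sup>2)"
    using exp_le_quadratic[OF lY] int
    by (intro integral_mono) (auto simp: power_mult_distrib)
  also have "\<dots> = 1 + l * expectation Y + l\<^sup>2 * expectation (\<lambda>\<omega>. (Y \<omega>)\<^sup>2)"
    using int by (simp add: prob_space)
  also have "\<dots> \<le> 1 + (\<bar>l\<bar> * m + l\<^sup>2 * v)"
  proof -
    have "l * expectation Y \<le> \<bar>l\<bar> * m"
      using mult_left_mono[OF mean, of "\<bar>l\<bar>"] abs_ge_self[of "l * expectation Y"] by (simp add: abs_mult)
    moreover have "l\<^sup>2 * expectation (\<lambda>\<omega>. (Y \<omega>)\<^sup>2) \<le> l\<^sup>2 * v" using var by (intro mult_left_mono) auto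
    ultimately show ?thesis by linarith
  qed
  also have "\<dots> \<le> exp (\<bar>l\<bar> * m + l\<^sup>2 * v)" by (rule exp_ge_add_one_self)
  finally show ?thesis .
qed

text \<open>The exponential moment of the maximum is at most the sum of the exponential moments of the \<open>2 d\<close>
  signed column sums, which factor over the independent summands.\<close>

lemma expectation_Max_abs_sum_bounded:
  fixes T :: "nat \<Rightarrow> nat \<Rightarrow> 'a \<Rightarrow> real"
  assumes I: "finite I" and d: "d > 0"
    and indep: "\<And>j. j < d \<Longrightarrow> indep_vars (\<lambda>_. borel) (\<lambda>i. T i j) I"
    and bounded: "\<And>i j \<omega>. \<bar>T i j \<omega>\<bar> \<le> \<tau>"
    and mean: "\<And>i j. i \<in> I \<Longrightarrow> j < d \<Longrightarrow> \<bar>expectation (T i j)\<bar> \<le> m"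
    and var: "\<And>i j. i \<in> I \<Longrightarrow> j < d \<Longrightarrow> expectation (\<lambda>\<omega>. (T i j \<omega>)\<^sup>2) \<le> v"
    and l: "l > 0" "l * \<tau> \<le> 1"
  shows "integrable M (\<lambda>\<omega>. Max ((\<lambda>j. \<bar>\<Sum>i\<in>I. T i j \<omega>\<bar>) ` {..<d}))"
    and "expectation (\<lambda>\<omega>. Max ((\<lambda>j. \<bar>\<Sum>i\<in>I. T i j \<omega>\<bar>) ` {..<d}))
           \<le> ln (2 * real d) / l + real (card I) * (m + l * v)"
proof -
  define S where "S j \<omega> = (\<Sum>i\<in>I. T i j \<omega>)" for j \<omega>
  define Z where "Z \<omega> = Max ((\<lambda>j. \<bar>S j \<omega>\<bar>) ` {..<d})" for \<omega>
  have ne: "{..<d} \<noteq> {}" using d by auto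
  have T_rv [measurable]: "random_variable borel (T i j)" if "i \<in> I" "j < d" for i j
    using indep[OF that(2)] that(1) by (auto simp: indep_vars_def)
  have S_rv [measurable]: "random_variable borel (S j)" if "j < d" for j
    unfolding S_def using that by (intro borel_measurable_sum T_rv) auto
  have Z_rv [measurable]: "random_variable borel Z"
    unfolding Z_def by (intro borel_measurable_Max) auto
  have S_bd: "\<bar>S j \<omega>\<bar> \<le> real (card I) * \<tau>" for j \<omega>
    unfolding S_def using bounded by (intro order_trans[OF sum_abs] sum_bounded_above) auto
  have Z_bd: "\<bar>Z \<omega>\<bar> \<le> real (card I) * \<tau>" for \<omega>
  proof -
    have "Z \<omega> \<in> (\<lambda>j. \<bar>S j \<omega>\<bar>) ` {..<d}" unfolding Z_def using ne by (intro Max_in) auto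
    then show ?thesis using S_bd by auto
  qed
  have int_Z: "integrable M Z"
    using Z_bd by (intro integrable_const_bound[of _ "real (card I) * \<tau>"]) auto
  then show "integrable M (\<lambda>\<omega>. Max ((\<lambda>j. \<bar>\<Sum>i\<in>I. T i j \<omega>\<bar>) ` {..<d}))"
    by (simp add: Z_def[abs_def] S_def)
  define b where "b = real (card I) * (l * m + l\<^sup>2 * v)"
  have int_exp: "integrable M (\<lambda>\<omega>. exp (a * S j \<omega>))" if "j < d" for a j
  proof (rule integrable_const_bound[of _ "exp (\<bar>a\<bar> * (real (card I) * \<tau>))"])
    show "AE \<omega> in M. norm (exp (a * S j \<omega>)) \<le> exp (\<bar>a\<bar> * (real (card I) * \<tau>))"
    proof (intro AE_I2)
      fix \<omega>
      have "a * S j \<omega> \<le> \<bar>a\<bar> * \<bar>S j \<omega>\<bar>" using abs_ge_self[of "a * S j \<omega>"] by (simp add: abs_mult)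
      also have "\<dots> \<le> \<bar>a\<bar> * (real (card I) * \<tau>)" using S_bd by (intro mult_left_mono) auto
      finally show "norm (exp (a * S j \<omega>)) \<le> exp (\<bar>a\<bar> * (real (card I) * \<tau>))" by simp
    qed
  qed (use that in measurable)
  have mgf: "expectation (\<lambda>\<omega>. exp (a * S j \<omega>)) \<le> exp b" if a: "\<bar>a\<bar> = l" and j: "j < d" for a j
  proof -
    have ind: "indep_vars (\<lambda>_. borel) (\<lambda>i \<omega>. exp (a * T i j \<omega>)) I"
      by (rule indep_vars_compose2[OF indep[OF j]]) simp
    have "expectation (\<lambda>\<omega>. exp (a * S j \<omega>)) = expectation (\<lambda>\<omega>. \<Prod>i\<in>I. exp (a * T i j \<omega>))"
      by (simp add: S_def sum_distrib_left exp_sum I)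
    also have "\<dots> = (\<Prod>i\<in>I. expectation (\<lambda>\<omega>. exp (a * T i j \<omega>)))"
    proof (rule indep_vars_lebesgue_integral[OF I ind])
      fix i assume "i \<in> I"
      show "integrable M (\<lambda>\<omega>. exp (a * T i j \<omega>))"
      proof (rule integrable_const_bound[of _ "exp 1"])
        have "a * T i j \<omega> \<le> 1" for \<omega>
          using order_trans[OF mult_left_mono[OF bounded[of i j \<omega>], of l] l(2)] l(1) a
            abs_ge_self[of "a * T i j \<omega>"]
          by (simp add: abs_mult)
        then show "AE \<omega> in M. norm (exp (a * T i j \<omega>)) \<le> exp 1" by simp
      qed (use \<open>i \<in> I\<close> j in measurable)
    qed
    also have "\<dots> \<le> (\<Prod>i\<in>I. exp (l * m + l\<^sup>2 * v))"
    proof (rule prod_mono)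
      fix i assume i: "i \<in> I"
      have "expectation (\<lambda>\<omega>. exp (a * T i j \<omega>)) \<le> exp (\<bar>a\<bar> * m + a\<^sup>2 * v)"
        by (rule mgf_bounded_le[OF T_rv[OF i j] bounded mean[OF i j] var[OF i j]]) (use a l in simp)
      moreover have "a\<^sup>2 = l\<^sup>2" using a by (metis power2_abs)
      ultimately show "0 \<le> expectation (\<lambda>\<omega>. exp (a * T i j \<omega>)) \<and>
          expectation (\<lambda>\<omega>. exp (a * T i j \<omega>)) \<le> exp (l * m + l\<^sup>2 * v)"
        using a by simp
    qed
    also have "\<dots> = exp b" by (simp add: b_def exp_of_nat_mult)
    finally show ?thesis .
  qed
  \<comment> \<open>This form of Jensen's inequality is the tangent of exp at the logarithm of the bound
    on the exponential moment.\<close>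
  define A where "A = 2 * real d * exp b"
  have A: "A > 0" using d by (simp add: A_def)
  have point: "l * Z \<omega> \<le> ln A - 1 + (\<Sum>j<d. exp (l * S j \<omega>) + exp (- l * S j \<omega>)) / A" for \<omega>
  proof -
    obtain j where j: "j < d" "Z \<omega> = \<bar>S j \<omega>\<bar>"
    proof -
      have "Z \<omega> \<in> (\<lambda>j. \<bar>S j \<omega>\<bar>) ` {..<d}" unfolding Z_def using ne by (intro Max_in) auto
      then show ?thesis using that by blast
    qed
    have "exp (l * Z \<omega>) \<le> exp (l * S j \<omega>) + exp (- l * S j \<omega>)"
      using j(2) by (cases "S j \<omega> \<ge> 0") auto
    also have "\<dots> \<le> (\<Sum>j<d. exp (l * S j \<omega>) + exp (- l * S j \<omega>))"
      using j(1) by (intro member_le_sum) (auto simp: add_nonneg_nonneg)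
    finally have le: "exp (l * Z \<omega>) / A \<le> (\<Sum>j<d. exp (l * S j \<omega>) + exp (- l * S j \<omega>)) / A"
      using A by (simp add: divide_right_mono)
    have "1 + (l * Z \<omega> - ln A) \<le> exp (l * Z \<omega> - ln A)" by (rule exp_ge_add_one_self)
    also have "\<dots> = exp (l * Z \<omega>) / A" using A by (simp add: exp_diff)
    finally show ?thesis using le by linarith
  qed
  define Q where "Q \<omega> = (\<Sum>j<d. exp (l * S j \<omega>) + exp (- l * S j \<omega>))" for \<omega>
  have int_Q: "integrable M Q"
    unfolding Q_def by (intro Bochner_Integration.integrable_sum Bochner_Integration.integrable_add int_exp) auto
  have Q_exp: "expectation Q = (\<Sum>j<d. expectation (\<lambda>\<omega>. exp (l * S j \<omega>)) + expectation (\<lambda>\<omega>. exp (- l * S j \<omega>)))"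
  proof -
    have "expectation Q = (\<Sum>j<d. expectation (\<lambda>\<omega>. exp (l * S j \<omega>) + exp (- l * S j \<omega>)))"
      unfolding Q_def by (intro Bochner_Integration.integral_sum Bochner_Integration.integrable_add int_exp) auto
    also have "\<dots> = (\<Sum>j<d. expectation (\<lambda>\<omega>. exp (l * S j \<omega>)) + expectation (\<lambda>\<omega>. exp (- l * S j \<omega>)))"
      by (intro sum.cong refl Bochner_Integration.integral_add int_exp) auto
    finally show ?thesis .
  qed
  have "l * expectation Z = expectation (\<lambda>\<omega>. l * Z \<omega>)" by simp
  also have "\<dots> \<le> expectation (\<lambda>\<omega>. ln A - 1 + Q \<omega> / A)"
    using int_Z int_Q point unfolding Q_def[symmetric] by (intro integral_mono) auto
  also have "\<dots> = ln A - 1 + expectation Q / A"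
    using int_Q by (simp add: prob_space)
  also have "\<dots> \<le> ln A - 1 + (\<Sum>j<d. exp b + exp b) / A"
    unfolding Q_exp using A mgf[of l] mgf[of "- l"] l
    by (intro add_left_mono divide_right_mono sum_mono add_mono) auto
  also have "\<dots> = ln (2 * real d) + b"
    using d by (simp add: A_def ln_mult)
  finally have "expectation Z \<le> (ln (2 * real d) + b) / l" using l by (simp add: field_simps)
  also have "\<dots> = ln (2 * real d) / l + real (card I) * (m + l * v)"
    using l by (simp add: b_def field_simps power2_eq_square)
  finally show "expectation (\<lambda>\<omega>. Max ((\<lambda>j. \<bar>\<Sum>i\<in>I. T i j \<omega>\<bar>) ` {..<d}))
           \<le> ln (2 * real d) / l + real (card I) * (m + l * v)"
    by (simp add: Z_def[abs_def] S_def)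
qed

end

text \<open>The level \<open>\<tau>\<close> equates \<open>D \<tau>\<close> with \<open>k F / \<tau>\<^sup>3\<close>, where \<open>F = K n\<^bsup>2 - 4 \<alpha>\<^esup> / D\<close> bounds the fourth
  moment and \<open>D\<close> stands for \<open>log d\<close>. The exponent \<open>l\<close> is \<open>1 / r\<close>, up to a constant the best choice for sub-Gaussian sums of
  variance \<open>k v\<close>, capped at \<open>1 / \<tau>\<close>, where the quadratic bound on exp stops.\<close>

lemma truncation_tuning:
  fixes k n D v K \<alpha> :: real
  assumes k: "1 \<le> k" "k \<le> n" and D: "D > 0" and v: "v > 0" and K: "K > 0"
    and \<alpha>: "1 / 4 \<le> \<alpha>" "\<alpha> \<le> 1 / 2"
  obtains \<tau> l where "\<tau> > 0" "l > 0" "l * \<tau> \<le> 1"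
    "2 * D / l + k * (2 * (K * n powr (2 - 4 * \<alpha>) / D) / \<tau> ^ 3 + l * v)
       \<le> (4 * K powr (1 / 4) + 3 * sqrt v) * sqrt D * n powr (1 / 2 - \<alpha>) * k powr \<alpha>"
proof -
  have n: "n > 0" using k by linarith
  have DD: "sqrt D = D / sqrt D" using D by (simp add: real_div_sqrt)
  define F where "F = K * n powr (2 - 4 * \<alpha>) / D"
  define \<tau> where "\<tau> = K powr (1 / 4) * k powr (1 / 4) * n powr (1 / 2 - \<alpha>) / sqrt D"
  have \<tau>: "\<tau> > 0" using K k n D by (simp add: \<tau>_def)
  have "\<tau> ^ 4 = (K powr (1 / 4)) ^ 4 * (k powr (1 / 4)) ^ 4 * (n powr (1 / 2 - \<alpha>)) ^ 4 / (sqrt D) ^ 4"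
    by (simp add: \<tau>_def power_mult_distrib power_divide)
  also have "(K powr (1 / 4)) ^ 4 = K" using K by (simp add: powr_power)
  also have "(k powr (1 / 4)) ^ 4 = k" using k by (simp add: powr_power)
  also have "(n powr (1 / 2 - \<alpha>)) ^ 4 = n powr (2 - 4 * \<alpha>)"
    using n by (simp add: powr_power algebra_simps)
  also have "(sqrt D) ^ 4 = D\<^sup>2"
    using D by (simp add: power4_eq_xxxx power2_eq_square)
  finally have \<tau>4: "\<tau> ^ 4 = k * F / D" by (simp add: F_def power2_eq_square)
  define r where "r = sqrt (k * v / D)"
  have r: "r > 0" "r\<^sup>2 = k * v / D" using k v D by (auto simp: r_def)
  define l where "l = 1 / max \<tau> r"
  have l: "l > 0" "l * \<tau> \<le> 1" "l \<le> 1 / r" "1 / l \<le> \<tau> + r"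
    using \<tau> r by (auto simp: l_def max_def field_simps)
  have "2 * D / l \<le> 2 * D * \<tau> + 2 * D * r"
    using mult_left_mono[OF l(4), of "2 * D"] D by (simp add: algebra_simps)
  moreover have "k * (2 * F / \<tau> ^ 3) = 2 * D * \<tau>"
  proof -
    have "k * F = D * (\<tau> * \<tau> ^ 3)" using \<tau>4 D by (simp add: power4_eq_xxxx power3_eq_cube field_simps)
    then show ?thesis using \<tau> by (simp add: field_simps)
  qed
  moreover have "k * (l * v) \<le> D * r"
  proof -
    have "k * (l * v) \<le> k * (1 / r * v)" using l(3) k v by (intro mult_left_mono mult_right_mono) auto
    also have "\<dots> = D * r" using r D by (simp add: field_simps power2_eq_square)
    finally show ?thesis .
  qed
  ultimately have "2 * D / l + k * (2 * F / \<tau> ^ 3 + l * v) \<le> 4 * (D * \<tau>) + 3 * (D * r)"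
    by (simp add: distrib_left)
  moreover have "D * \<tau> \<le> K powr (1 / 4) * (sqrt D * n powr (1 / 2 - \<alpha>) * k powr \<alpha>)"
  proof -
    have "D * \<tau> = K powr (1 / 4) * (sqrt D * n powr (1 / 2 - \<alpha>) * k powr (1 / 4))"
      unfolding \<tau>_def by (subst (2) DD) (simp add: mult_ac)
    also have "\<dots> \<le> K powr (1 / 4) * (sqrt D * n powr (1 / 2 - \<alpha>) * k powr \<alpha>)"
      using D k \<alpha> by (intro mult_left_mono powr_mono) auto
    finally show ?thesis .
  qed
  moreover have "D * r \<le> sqrt v * (sqrt D * n powr (1 / 2 - \<alpha>) * k powr \<alpha>)"
  proof -
    have "D * r = sqrt v * (sqrt D * k powr (1 / 2))"
    proof -
      have "D * r = sqrt k * sqrt v * (D / sqrt D)"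
        by (simp add: r_def real_sqrt_divide real_sqrt_mult del: real_div_sqrt)
      also have "\<dots> = sqrt v * (sqrt D * k powr (1 / 2))"
        unfolding DD[symmetric] using k by (simp add: powr_half_sqrt)
      finally show ?thesis .
    qed
    also have "k powr (1 / 2) = k powr (1 / 2 - \<alpha>) * k powr \<alpha>" by (simp add: powr_add[symmetric])
    also have "sqrt v * (sqrt D * (k powr (1 / 2 - \<alpha>) * k powr \<alpha>))
        \<le> sqrt v * (sqrt D * (n powr (1 / 2 - \<alpha>) * k powr \<alpha>))"
      using D v k \<alpha> by (intro mult_left_mono mult_right_mono powr_mono2) auto
    finally show ?thesis by (simp add: mult.assoc)
  qed
  ultimately have "2 * D / l + k * (2 * F / \<tau> ^ 3 + l * v)
     \<le> 4 * (K powr (1 / 4) * (sqrt D * n powr (1 / 2 - \<alpha>) * k powr \<alpha>))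
       + 3 * (sqrt v * (sqrt D * n powr (1 / 2 - \<alpha>) * k powr \<alpha>))" by linarith
  also have "\<dots> = (4 * K powr (1 / 4) + 3 * sqrt v) * sqrt D * n powr (1 / 2 - \<alpha>) * k powr \<alpha>"
    by (simp add: algebra_simps)
  finally show ?thesis using that[OF \<tau> l(1,2)] by (simp add: F_def)
qed

context prob_space
begin

text \<open>A row is kept only if all its entries are at most \<open>\<tau>\<close>, so one event per row serves all columns and the
  kept rows remain independent. A discarded row changes every column sum by at most its largest entry,
  and for entries above \<open>\<tau>\<close> that is at most their fourth power divided by \<open>\<tau>\<^sup>3\<close>. The same quantity bounds the mean of a
  truncated entry, hence the factor 2.\<close>

lemma expectation_Max_abs_sum_rows:
  fixes x :: "nat \<Rightarrow> nat \<Rightarrow> 'a \<Rightarrow> real"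
  assumes d: "d > 0" and I: "I \<subseteq> {..<n}"
    and indep: "indep_vars (\<lambda>_. Pi\<^sub>M {..<d} (\<lambda>_. borel)) (\<lambda>i \<omega>. \<lambda>j\<in>{..<d}. x i j \<omega>) {..<n}"
    and mean: "\<And>i j. i < n \<Longrightarrow> j < d \<Longrightarrow> mean_zero M (x i j)"
    and sq: "\<And>i j. i < n \<Longrightarrow> j < d \<Longrightarrow> integrable M (\<lambda>\<omega>. (x i j \<omega>)\<^sup>2)"
    and var: "\<And>i j. i < n \<Longrightarrow> j < d \<Longrightarrow> expectation (\<lambda>\<omega>. (x i j \<omega>)\<^sup>2) \<le> v"
    and fourth: "\<And>i. i < n \<Longrightarrow> (\<integral>\<^sup>+\<omega>. ennreal (Max ((\<lambda>j. \<bar>x i j \<omega>\<bar> ^ 4) ` {..<d})) \<partial>M) \<le> ennreal F"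
    and F: "F \<ge> 0" and \<tau>: "\<tau> > 0" and l: "l > 0" "l * \<tau> \<le> 1"
  shows "(\<integral>\<^sup>+\<omega>. ennreal (Max ((\<lambda>j. \<bar>\<Sum>i\<in>I. x i j \<omega>\<bar>) ` {..<d})) \<partial>M)
         \<le> ennreal (ln (2 * real d) / l + real (card I) * (2 * F / \<tau> ^ 3 + l * v))"
proof -
  define R where "R i \<omega> = Max ((\<lambda>j. \<bar>x i j \<omega>\<bar>) ` {..<d})" for i \<omega>
  define T where "T i j \<omega> = (if i < n \<and> j < d \<and> R i \<omega> \<le> \<tau> then x i j \<omega> else 0)" for i j \<omega>
  define E where "E i \<omega> = (if R i \<omega> \<le> \<tau> then 0 else R i \<omega>)" for i \<omega>
  have finI: "finite I" using I finite_subset by blast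
  have ne: "{..<d} \<noteq> {}" using d by auto
  have x_rv [measurable]: "random_variable borel (x i j)" if "i < n" "j < d" for i j
    using mean[OF that] by (auto simp: mean_zero_def)
  have R_rv [measurable]: "random_variable borel (R i)" if "i < n" for i
    unfolding R_def using that by (intro borel_measurable_Max borel_measurable_abs x_rv) auto
  have x_le_R: "\<bar>x i j \<omega>\<bar> \<le> R i \<omega>" if "j < d" for i j \<omega>
    unfolding R_def using that by (intro Max_ge) auto
  have R0: "R i \<omega> \<ge> 0" for i \<omega> using x_le_R[OF d, of i \<omega>] by linarith
  have T_bd: "\<bar>T i j \<omega>\<bar> \<le> \<tau>" for i j \<omega>
    using x_le_R[of j i \<omega>] \<tau> by (auto simp: T_def)
  have T_rv [measurable]: "random_variable borel (T i j)" if "i < n" "j < d" for i j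
    unfolding T_def using that by measurable
  have E_rv [measurable]: "random_variable borel (E i)" if "i < n" for i
    unfolding E_def using that by measurable
  have E0: "E i \<omega> \<ge> 0" for i \<omega> using R0 by (simp add: E_def)
  have E_le: "E i \<omega> \<le> Max ((\<lambda>j. \<bar>x i j \<omega>\<bar> ^ 4) ` {..<d}) / \<tau> ^ 3" for i \<omega>
  proof -
    have "R i \<omega> \<in> (\<lambda>j. \<bar>x i j \<omega>\<bar>) ` {..<d}" unfolding R_def using ne by (intro Max_in) auto
    then obtain j where j: "j < d" "R i \<omega> = \<bar>x i j \<omega>\<bar>" by blast
    have R4: "R i \<omega> ^ 4 \<le> Max ((\<lambda>j. \<bar>x i j \<omega>\<bar> ^ 4) ` {..<d})"
      unfolding j(2) using j(1) by (intro Max_ge) auto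
    show ?thesis
    proof (cases "R i \<omega> \<le> \<tau>")
      case True
      have "0 \<le> R i \<omega> ^ 4" by simp
      with R4 have "0 \<le> Max ((\<lambda>j. \<bar>x i j \<omega>\<bar> ^ 4) ` {..<d})" by (rule order_trans[rotated])
      then show ?thesis using True \<tau> by (simp add: E_def)
    next
      case False
      then have "R i \<omega> * \<tau> ^ 3 \<le> R i \<omega> * R i \<omega> ^ 3"
        using \<tau> R0 by (intro mult_left_mono power_mono) auto
      also have "\<dots> = R i \<omega> ^ 4" by (simp add: power4_eq_xxxx power3_eq_cube)
      finally have "R i \<omega> * \<tau> ^ 3 \<le> Max ((\<lambda>j. \<bar>x i j \<omega>\<bar> ^ 4) ` {..<d})" using R4 by linarith
      then show ?thesis using False \<tau> by (simp add: E_def pos_le_divide_eq)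
    qed
  qed
  have E_nn: "(\<integral>\<^sup>+\<omega>. ennreal (E i \<omega>) \<partial>M) \<le> ennreal (F / \<tau> ^ 3)" if i: "i < n" for i
  proof -
    have "(\<integral>\<^sup>+\<omega>. ennreal (E i \<omega>) \<partial>M)
        \<le> (\<integral>\<^sup>+\<omega>. ennreal (1 / \<tau> ^ 3) * ennreal (Max ((\<lambda>j. \<bar>x i j \<omega>\<bar> ^ 4) ` {..<d})) \<partial>M)"
      using E_le \<tau> by (intro nn_integral_mono) (auto simp: ennreal_mult'[symmetric] intro!: ennreal_leI)
    also have "\<dots> = ennreal (1 / \<tau> ^ 3) * (\<integral>\<^sup>+\<omega>. ennreal (Max ((\<lambda>j. \<bar>x i j \<omega>\<bar> ^ 4) ` {..<d})) \<partial>M)"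
      using i by (intro nn_integral_cmult measurable_compose[OF _ measurable_ennreal] borel_measurable_Max
        borel_measurable_power borel_measurable_abs x_rv) auto
    also have "\<dots> \<le> ennreal (1 / \<tau> ^ 3) * ennreal F" by (intro mult_left_mono fourth i) auto
    also have "\<dots> = ennreal (F / \<tau> ^ 3)" using F \<tau> by (simp add: ennreal_mult'[symmetric])
    finally show ?thesis .
  qed
  have E_int: "integrable M (E i)" and E_exp: "expectation (E i) \<le> F / \<tau> ^ 3" if i: "i < n" for i
  proof -
    show int: "integrable M (E i)"
      using E_nn[OF i] E0 i by (intro integrableI_bounded) (auto simp: le_less_trans)
    have "ennreal (expectation (E i)) \<le> ennreal (F / \<tau> ^ 3)"
      using E_nn[OF i] nn_integral_eq_integral[OF int] E0 by simp
    then show "expectation (E i) \<le> F / \<tau> ^ 3" using F \<tau> by (simp add: ennreal_le_iff)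
  qed
  have x_T: "\<bar>x i j \<omega> - T i j \<omega>\<bar> \<le> E i \<omega>" if "i < n" "j < d" for i j \<omega>
    using x_le_R[of j i \<omega>] that by (auto simp: T_def E_def)
  have T_int: "integrable M (T i j)" if "i < n" "j < d" for i j
    using T_bd that by (intro integrable_const_bound[of _ \<tau>]) auto
  have T_mean: "\<bar>expectation (T i j)\<bar> \<le> F / \<tau> ^ 3" if ij: "i < n" "j < d" for i j
  proof -
    have x: "integrable M (x i j)" "expectation (x i j) = 0" using mean[OF ij] by (auto simp: mean_zero_def)
    have "\<bar>expectation (T i j)\<bar> = \<bar>expectation (\<lambda>\<omega>. x i j \<omega> - T i j \<omega>)\<bar>"
      using x T_int[OF ij] by simp
    also have "\<dots> \<le> expectation (\<lambda>\<omega>. \<bar>x i j \<omega> - T i j \<omega>\<bar>)" by (rule integral_abs_bound)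
    also have "\<dots> \<le> expectation (E i)"
      using x T_int[OF ij] E_int[OF ij(1)] x_T[OF ij] by (intro integral_mono) auto
    also have "\<dots> \<le> F / \<tau> ^ 3" by (rule E_exp[OF ij(1)])
    finally show ?thesis .
  qed
  have T_var: "expectation (\<lambda>\<omega>. (T i j \<omega>)\<^sup>2) \<le> v" if ij: "i < n" "j < d" for i j
  proof -
    have "expectation (\<lambda>\<omega>. (T i j \<omega>)\<^sup>2) \<le> expectation (\<lambda>\<omega>. (x i j \<omega>)\<^sup>2)"
    proof (rule integral_mono[OF _ sq[OF ij]])
      show "integrable M (\<lambda>\<omega>. (T i j \<omega>)\<^sup>2)"
        by (rule Bochner_Integration.integrable_bound[OF sq[OF ij]]) (use ij in \<open>auto simp: T_def\<close>)
    qed (auto simp: T_def)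
    then show ?thesis using var[OF ij] by linarith
  qed
  have T_indep: "indep_vars (\<lambda>_. borel) (\<lambda>i. T i j) I" if j: "j < d" for j
  proof -
    define h where "h r = (if Max ((\<lambda>j'. \<bar>r j'\<bar>) ` {..<d}) \<le> \<tau> then r j else 0)" for r :: "nat \<Rightarrow> real"
    have comp: "(\<lambda>r. r j') \<in> borel_measurable (Pi\<^sub>M {..<d} (\<lambda>_. borel :: real measure))" if "j' < d" for j'
      using that by (intro measurable_component_singleton) auto
    have "(\<lambda>r. Max ((\<lambda>j'. \<bar>r j' :: real\<bar>) ` {..<d})) \<in> borel_measurable (Pi\<^sub>M {..<d} (\<lambda>_. borel))"
      using comp by (intro borel_measurable_Max borel_measurable_abs) auto
    then have h: "h \<in> borel_measurable (Pi\<^sub>M {..<d} (\<lambda>_. borel))"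
      unfolding h_def using comp[OF j] by measurable
    have "indep_vars (\<lambda>_. borel) (\<lambda>i \<omega>. h (\<lambda>j\<in>{..<d}. x i j \<omega>)) I"
      by (rule indep_vars_compose2[OF indep_vars_subset[OF indep I] h])
    moreover have "h (\<lambda>j\<in>{..<d}. x i j \<omega>) = T i j \<omega>" if "i \<in> I" for i \<omega>
    proof -
      have "(\<lambda>j'. \<bar>(\<lambda>j\<in>{..<d}. x i j \<omega>) j'\<bar>) ` {..<d} = (\<lambda>j. \<bar>x i j \<omega>\<bar>) ` {..<d}"
        by (rule image_cong) auto
      then show ?thesis using that I j by (auto simp: h_def T_def R_def)
    qed
    ultimately show ?thesis by (subst indep_vars_cong[OF refl _ refl, of _ _ "\<lambda>i \<omega>. h (\<lambda>j\<in>{..<d}. x i j \<omega>)"]) auto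
  qed
  define W where "W \<omega> = Max ((\<lambda>j. \<bar>\<Sum>i\<in>I. T i j \<omega>\<bar>) ` {..<d})" for \<omega>
  have W: "integrable M W" "expectation W \<le> ln (2 * real d) / l + real (card I) * (F / \<tau> ^ 3 + l * v)"
    unfolding W_def using I
    by (intro expectation_Max_abs_sum_bounded[OF finI d T_indep T_bd T_mean T_var l]; auto)+
  have W0: "W \<omega> \<ge> 0" for \<omega>
    unfolding W_def using d by (intro order_trans[OF abs_ge_zero Max_ge[of _ "\<bar>\<Sum>i\<in>I. T i 0 \<omega>\<bar>"]]) auto
  have split: "Max ((\<lambda>j. \<bar>\<Sum>i\<in>I. x i j \<omega>\<bar>) ` {..<d}) \<le> W \<omega> + (\<Sum>i\<in>I. E i \<omega>)" for \<omega>
  proof (rule Max.boundedI)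
    fix a assume "a \<in> (\<lambda>j. \<bar>\<Sum>i\<in>I. x i j \<omega>\<bar>) ` {..<d}"
    then obtain j where j: "j < d" "a = \<bar>\<Sum>i\<in>I. x i j \<omega>\<bar>" by auto
    have "a = \<bar>(\<Sum>i\<in>I. T i j \<omega>) + (\<Sum>i\<in>I. x i j \<omega> - T i j \<omega>)\<bar>"
      by (simp add: j sum_subtractf)
    also have "\<dots> \<le> \<bar>\<Sum>i\<in>I. T i j \<omega>\<bar> + (\<Sum>i\<in>I. \<bar>x i j \<omega> - T i j \<omega>\<bar>)"
      using sum_abs[of "\<lambda>i. x i j \<omega> - T i j \<omega>" I] by linarith
    also have "\<dots> \<le> W \<omega> + (\<Sum>i\<in>I. E i \<omega>)"
      unfolding W_def using j x_T I by (intro add_mono Max_ge sum_mono) auto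
    finally show "a \<le> W \<omega> + (\<Sum>i\<in>I. E i \<omega>)" .
  qed (use ne in auto)
  have int: "integrable M (\<lambda>\<omega>. W \<omega> + (\<Sum>i\<in>I. E i \<omega>))"
    using W E_int I by (intro Bochner_Integration.integrable_add Bochner_Integration.integrable_sum) auto
  have "(\<integral>\<^sup>+\<omega>. ennreal (Max ((\<lambda>j. \<bar>\<Sum>i\<in>I. x i j \<omega>\<bar>) ` {..<d})) \<partial>M)
      \<le> (\<integral>\<^sup>+\<omega>. ennreal (W \<omega> + (\<Sum>i\<in>I. E i \<omega>)) \<partial>M)"
    by (intro nn_integral_mono ennreal_leI split)
  also have "\<dots> = ennreal (expectation (\<lambda>\<omega>. W \<omega> + (\<Sum>i\<in>I. E i \<omega>)))"
    using W0 E0 by (intro nn_integral_eq_integral[OF int]) (auto intro!: add_nonneg_nonneg sum_nonneg)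
  also have "expectation (\<lambda>\<omega>. W \<omega> + (\<Sum>i\<in>I. E i \<omega>)) = expectation W + (\<Sum>i\<in>I. expectation (E i))"
    using W E_int I by (subst Bochner_Integration.integral_add)
      (auto intro!: Bochner_Integration.integrable_sum Bochner_Integration.integral_sum)
  also have "\<dots> \<le> ln (2 * real d) / l + real (card I) * (F / \<tau> ^ 3 + l * v) + (\<Sum>i\<in>I. F / \<tau> ^ 3)"
    using W E_exp I by (intro add_mono sum_mono) auto
  also have "\<dots> = ln (2 * real d) / l + real (card I) * (2 * F / \<tau> ^ 3 + l * v)"
    by (simp add: algebra_simps add_divide_distrib[symmetric])
  finally show ?thesis by (simp add: ennreal_leI)
qed

text \<open>The bound at the tuned truncation level. The dependence on \<open>card I\<close> through the power \<open>\<alpha>\<close> alone is the form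
  that integrates against the level sets of the noise.\<close>

lemma expectation_Max_abs_sum_rows_le:
  fixes x :: "nat \<Rightarrow> nat \<Rightarrow> 'a \<Rightarrow> real"
  assumes d: "d \<ge> 2" and I: "I \<subseteq> {..<n}"
    and indep: "indep_vars (\<lambda>_. Pi\<^sub>M {..<d} (\<lambda>_. borel)) (\<lambda>i \<omega>. \<lambda>j\<in>{..<d}. x i j \<omega>) {..<n}"
    and mean: "\<And>i j. i < n \<Longrightarrow> j < d \<Longrightarrow> mean_zero M (x i j)"
    and sq: "\<And>i j. i < n \<Longrightarrow> j < d \<Longrightarrow> integrable M (\<lambda>\<omega>. (x i j \<omega>)\<^sup>2)"
    and var: "\<And>i j. i < n \<Longrightarrow> j < d \<Longrightarrow> expectation (\<lambda>\<omega>. (x i j \<omega>)\<^sup>2) \<le> v"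
    and fourth: "\<And>i. i < n \<Longrightarrow> (\<integral>\<^sup>+\<omega>. ennreal (Max ((\<lambda>j. \<bar>x i j \<omega>\<bar> ^ 4) ` {..<d})) \<partial>M)
        \<le> ennreal (K * real n powr (2 - 4 * \<alpha>) / ln (real d))"
    and v: "v > 0" and K: "K > 0" and \<alpha>: "1 / 4 \<le> \<alpha>" "\<alpha> \<le> 1 / 2"
  shows "(\<integral>\<^sup>+\<omega>. ennreal (Max ((\<lambda>j. \<bar>\<Sum>i\<in>I. x i j \<omega>\<bar>) ` {..<d})) \<partial>M)
     \<le> ennreal ((4 * K powr (1 / 4) + 3 * sqrt v) * sqrt (ln (real d)) * real n powr (1 / 2 - \<alpha>)
                 * real (card I) powr \<alpha>)"
proof (cases "I = {}")
  case True
  have "(\<lambda>j. \<bar>\<Sum>i\<in>I. x i j \<omega>\<bar>) ` {..<d} = {0}" for \<omega>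
    using True d by (simp add: image_constant_conv lessThan_empty_iff)
  then show ?thesis by simp
next
  case False
  have finI: "finite I" using I finite_subset by blast
  define k where "k = real (card I)"
  have "card I \<ge> 1" using False finI by (simp add: Suc_le_eq card_gt_0_iff)
  moreover have "card I \<le> n" using card_mono[OF _ I] by simp
  ultimately have k: "1 \<le> k" "k \<le> real n" by (auto simp: k_def)
  have D: "ln (real d) > 0" using d by simp
  obtain \<tau> l where \<tau>l: "\<tau> > 0" "l > 0" "l * \<tau> \<le> 1"
    and bound: "2 * ln (real d) / l + k * (2 * (K * real n powr (2 - 4 * \<alpha>) / ln (real d)) / \<tau> ^ 3 + l * v)
       \<le> (4 * K powr (1 / 4) + 3 * sqrt v) * sqrt (ln (real d)) * real n powr (1 / 2 - \<alpha>) * k powr \<alpha>"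
    by (rule truncation_tuning[OF k D v K \<alpha>])
  have "ln (2 * real d) \<le> 2 * ln (real d)" using d by (simp add: ln_mult)
  then have "ln (2 * real d) / l \<le> 2 * ln (real d) / l" using \<tau>l by (intro divide_right_mono) auto
  have "(\<integral>\<^sup>+\<omega>. ennreal (Max ((\<lambda>j. \<bar>\<Sum>i\<in>I. x i j \<omega>\<bar>) ` {..<d})) \<partial>M)
     \<le> ennreal (ln (2 * real d) / l
          + real (card I) * (2 * (K * real n powr (2 - 4 * \<alpha>) / ln (real d)) / \<tau> ^ 3 + l * v))"
    using d K D by (intro expectation_Max_abs_sum_rows[OF _ I indep mean sq var fourth _ \<tau>l]) auto
  also have "\<dots> \<le> ennreal ((4 * K powr (1 / 4) + 3 * sqrt v) * sqrt (ln (real d)) * real n powr (1 / 2 - \<alpha>)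
                 * real (card I) powr \<alpha>)"
    using bound \<open>ln (2 * real d) / l \<le> 2 * ln (real d) / l\<close> unfolding k_def by (intro ennreal_leI) linarith
  finally show ?thesis .
qed

end

section \<open>A multiplier inequality for dependent multipliers\<close>

text \<open>The signed layer cake formula for one number.\<close>

lemma integral_level_sets:
  fixes y :: real
  shows "has_bochner_integral lborel (\<lambda>t. indicator {t. 0 \<le> t \<and> t < y} t - indicator {t. 0 \<le> t \<and> t < - y} t) y"
proof -
  have "has_bochner_integral lborel (\<lambda>t. indicator {0..<y} t - indicator {0..<- y} t :: real) (max 0 y - max 0 (- y))"
  proof (intro has_bochner_integral_diff)
    have *: "has_bochner_integral lborel (indicator {0..<z}) (max 0 z)" for z :: real
      using has_bochner_integral_real_indicator[of "{0..<z}" lborel] by (auto simp: max_def split: if_splits)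
    show "has_bochner_integral lborel (indicator {0..<y}) (max 0 y)" by (rule *)
    show "has_bochner_integral lborel (indicator {0..<-y}) (max 0 (-y))" by (rule *)
  qed
  moreover have "max 0 y - max 0 (- y) = y" by auto
  moreover have "{t. 0 \<le> t \<and> t < y} = {0..<y}" "{t. 0 \<le> t \<and> t < - y} = {0..<- y}" by auto
  ultimately show ?thesis by simp
qed

text \<open>Jensen's inequality for the power \<open>\<alpha> \<le> 1\<close> and a finitely supported distribution. It follows from the weighted
  inequality of arithmetic and geometric means between each point and the mean.\<close>

lemma sum_powr_concave:
  fixes p x :: "'i \<Rightarrow> real"
  assumes A: "finite A" and p: "\<And>i. i \<in> A \<Longrightarrow> p i \<ge> 0" "(\<Sum>i\<in>A. p i) = 1"
    and x: "\<And>i. i \<in> A \<Longrightarrow> x i \<ge> 0" and \<alpha>: "0 < \<alpha>" "\<alpha> \<le> 1"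
  shows "(\<Sum>i\<in>A. p i * x i powr \<alpha>) \<le> (\<Sum>i\<in>A. p i * x i) powr \<alpha>"
proof -
  define m where "m = (\<Sum>i\<in>A. p i * x i)"
  have m0: "m \<ge> 0" unfolding m_def using p x by (intro sum_nonneg) auto
  show ?thesis
  proof (cases "m = 0")
    case True
    then have "p i * x i = 0" if "i \<in> A" for i
      using sum_nonneg_eq_0_iff[OF A, of "\<lambda>i. p i * x i"] p x that unfolding m_def by auto
    then have "(\<Sum>i\<in>A. p i * x i powr \<alpha>) = 0" by (intro sum.neutral) (auto simp: mult_eq_0_iff)
    then show ?thesis by simp
  next
    case False
    then have m: "m > 0" using m0 by simp
    have "(\<Sum>i\<in>A. p i * x i powr \<alpha>) * m powr (1 - \<alpha>) = (\<Sum>i\<in>A. p i * (x i powr \<alpha> * m powr (1 - \<alpha>)))"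
      by (simp add: sum_distrib_right mult.assoc)
    also have "\<dots> \<le> (\<Sum>i\<in>A. p i * (\<alpha> * x i + (1 - \<alpha>) * m))"
    proof (intro sum_mono mult_left_mono)
      fix i assume "i \<in> A"
      then show "x i powr \<alpha> * m powr (1 - \<alpha>) \<le> \<alpha> * x i + (1 - \<alpha>) * m"
        using x[of i] m \<alpha> Youngs_inequality_0[of \<alpha> "1 - \<alpha>" "x i" m] by (cases "x i = 0") auto
    qed (use p in auto)
    also have "\<dots> = \<alpha> * (\<Sum>i\<in>A. p i * x i) + (1 - \<alpha>) * m * (\<Sum>i\<in>A. p i)"
      by (simp add: distrib_left sum.distrib sum_distrib_left mult_ac)
    also have "\<dots> = m" using p by (simp add: m_def[symmetric] algebra_simps)
    also have "\<dots> = m powr \<alpha> * m powr (1 - \<alpha>)" using m by (simp add: powr_add[symmetric])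
    finally show ?thesis using m by (simp add: m_def)
  qed
qed

context prob_space
begin

text \<open>Restricting the measure to an event generated by \<open>V\<close> scales the law of \<open>U\<close> by the
  probability of that event.\<close>

lemma indep_elements_nn_integral_mult:
  assumes ind: "indep_elements M S U T V" and h [measurable]: "h \<in> borel_measurable S"
    and B [measurable]: "B \<in> sets T"
  shows "(\<integral>\<^sup>+\<omega>. h (U \<omega>) * indicator B (V \<omega>) \<partial>M) = (\<integral>\<^sup>+\<omega>. h (U \<omega>) \<partial>M) * prob {\<omega>\<in>space M. V \<omega> \<in> B}"
proof -
  have U [measurable]: "U \<in> measurable M S" and V [measurable]: "V \<in> measurable M T"
    and ind: "indep_set {U -` A \<inter> space M | A. A \<in> sets S} {V -` B \<inter> space M | B. B \<in> sets T}"
    using ind by (auto simp: indep_elements_def)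
  let ?p = "prob {\<omega>\<in>space M. V \<omega> \<in> B}"
  define \<mu> where "\<mu> = distr (density M (\<lambda>\<omega>. indicator B (V \<omega>))) S U"
  have "\<mu> = scale_measure ?p (distr M S U)"
  proof (rule measure_eqI)
    fix A assume "A \<in> sets \<mu>"
    then have A [measurable]: "A \<in> sets S" by (simp add: \<mu>_def)
    have "emeasure \<mu> A = (\<integral>\<^sup>+\<omega>. indicator B (V \<omega>) * indicator (U -` A \<inter> space M) \<omega> \<partial>M)"
      by (simp add: \<mu>_def emeasure_distr emeasure_density)
    also have "\<dots> = (\<integral>\<^sup>+\<omega>. indicator ((U -` A \<inter> space M) \<inter> (V -` B \<inter> space M)) \<omega> \<partial>M)"
      by (intro nn_integral_cong) (auto split: split_indicator)
    also have "\<dots> = prob ((U -` A \<inter> space M) \<inter> (V -` B \<inter> space M))"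
      by (simp add: emeasure_eq_measure)
    also have "prob ((U -` A \<inter> space M) \<inter> (V -` B \<inter> space M)) = prob (U -` A \<inter> space M) * prob (V -` B \<inter> space M)"
      by (rule indep_setD[OF ind]) (use A B in auto)
    also have "V -` B \<inter> space M = {\<omega>\<in>space M. V \<omega> \<in> B}" by auto
    finally show "emeasure \<mu> A = emeasure (scale_measure ?p (distr M S U)) A"
      by (simp add: emeasure_distr emeasure_eq_measure ennreal_mult' mult.commute)
  qed (simp add: \<mu>_def)
  then have "integral\<^sup>N \<mu> h = ?p * integral\<^sup>N (distr M S U) h" by (simp add: nn_integral_scale_measure)
  then show ?thesis by (simp add: \<mu>_def nn_integral_distr nn_integral_density mult.commute)
qed

text \<open>A random subset of \<open>{..<n}\<close> takes finitely many values, and conditioning on each of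
  them, by independence, reduces to the hypothesis on fixed sets.\<close>

lemma nn_integral_random_index_set:
  fixes f :: "nat \<Rightarrow> nat \<Rightarrow> 'u \<Rightarrow> real" and B :: "nat \<Rightarrow> 'v set"
  assumes ind: "indep_elements M S U T V"
    and f: "\<And>i j. i < n \<Longrightarrow> j < d \<Longrightarrow> f i j \<in> borel_measurable S"
    and B: "\<And>i. i < n \<Longrightarrow> B i \<in> sets T"
    and b: "b \<ge> 0" and \<alpha>: "0 < \<alpha>" "\<alpha> \<le> 1"
    and fixed: "\<And>I. I \<subseteq> {..<n} \<Longrightarrow>
       (\<integral>\<^sup>+\<omega>. ennreal (Max ((\<lambda>j. \<bar>\<Sum>i\<in>I. f i j (U \<omega>)\<bar>) ` {..<d})) \<partial>M) \<le> ennreal (b * real (card I) powr \<alpha>)"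
  shows "(\<integral>\<^sup>+\<omega>. ennreal (Max ((\<lambda>j. \<bar>\<Sum>i\<in>{i. i < n \<and> V \<omega> \<in> B i}. f i j (U \<omega>)\<bar>) ` {..<d})) \<partial>M)
         \<le> ennreal (b * (\<Sum>i<n. prob {\<omega>\<in>space M. V \<omega> \<in> B i}) powr \<alpha>)"
proof -
  have U [measurable]: "U \<in> measurable M S" and V [measurable]: "V \<in> measurable M T"
    using ind by (auto simp: indep_elements_def)
  define h where "h I u = ennreal (Max ((\<lambda>j. \<bar>\<Sum>i\<in>I. f i j u\<bar>) ` {..<d}))" for I u
  define C where "C I = {v\<in>space T. {i. i < n \<and> v \<in> B i} = I}" for I
  have h: "h I \<in> borel_measurable S" if "I \<subseteq> {..<n}" for I
    unfolding h_def using f that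
    by (intro measurable_compose[OF _ measurable_ennreal] borel_measurable_Max borel_measurable_abs borel_measurable_sum) auto
  have C [measurable]: "C I \<in> sets T" if I: "I \<in> Pow {..<n}" for I
  proof -
    have "C I = space T \<inter> (\<Inter>i\<in>{..<n}. if i \<in> I then B i else space T - B i)"
      using I by (auto simp: C_def split: if_splits)
    also have "\<dots> = (\<Inter>i\<in>{..<n} \<union> {n}. if i = n then space T else if i \<in> I then B i else space T - B i)"
      by auto
    also have "\<dots> \<in> sets T" using B by (intro sets.finite_INT) auto
    finally show ?thesis .
  qed
  define p where "p I = prob {\<omega>\<in>space M. V \<omega> \<in> C I}" for I
  have VC: "V \<omega> \<in> C I \<longleftrightarrow> {i. i < n \<and> V \<omega> \<in> B i} = I" if "\<omega> \<in> space M" for \<omega> I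
    using measurable_space[OF V that] by (auto simp: C_def)
  have ev_C [measurable]: "{\<omega>\<in>space M. V \<omega> \<in> C I} \<in> events" if "I \<in> Pow {..<n}" for I
    using C[OF that] by measurable
  have ev_B [measurable]: "{\<omega>\<in>space M. V \<omega> \<in> B i} \<in> events" if "i < n" for i
    using B[OF that] by measurable
  have "(\<integral>\<^sup>+\<omega>. ennreal (Max ((\<lambda>j. \<bar>\<Sum>i\<in>{i. i < n \<and> V \<omega> \<in> B i}. f i j (U \<omega>)\<bar>) ` {..<d})) \<partial>M)
      = (\<integral>\<^sup>+\<omega>. (\<Sum>I\<in>Pow {..<n}. h I (U \<omega>) * indicator (C I) (V \<omega>)) \<partial>M)"
  proof (rule nn_integral_cong)
    fix \<omega> assume \<omega>: "\<omega> \<in> space M"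
    let ?I = "{i. i < n \<and> V \<omega> \<in> B i}"
    have "(\<Sum>I\<in>Pow {..<n}. h I (U \<omega>) * indicator (C I) (V \<omega>))
        = (\<Sum>I\<in>Pow {..<n}. if I = ?I then h ?I (U \<omega>) else 0)"
      using VC[OF \<omega>] by (intro sum.cong) (auto simp: indicator_def)
    also have "\<dots> = h ?I (U \<omega>)" by (subst sum.delta) auto
    finally show "ennreal (Max ((\<lambda>j. \<bar>\<Sum>i\<in>?I. f i j (U \<omega>)\<bar>) ` {..<d}))
       = (\<Sum>I\<in>Pow {..<n}. h I (U \<omega>) * indicator (C I) (V \<omega>))" by (simp add: h_def)
  qed
  also have "\<dots> = (\<Sum>I\<in>Pow {..<n}. (\<integral>\<^sup>+\<omega>. h I (U \<omega>) * indicator (C I) (V \<omega>) \<partial>M))"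
    using measurable_compose[OF U h] C V by (intro nn_integral_sum) auto
  also have "\<dots> = (\<Sum>I\<in>Pow {..<n}. (\<integral>\<^sup>+\<omega>. h I (U \<omega>) \<partial>M) * ennreal (p I))"
    unfolding p_def using h C by (intro sum.cong indep_elements_nn_integral_mult[OF ind]) auto
  also have "\<dots> \<le> (\<Sum>I\<in>Pow {..<n}. ennreal (b * real (card I) powr \<alpha>) * ennreal (p I))"
    unfolding h_def using fixed by (intro sum_mono mult_right_mono) auto
  also have "\<dots> = ennreal (b * (\<Sum>I\<in>Pow {..<n}. p I * real (card I) powr \<alpha>))"
    using b by (simp add: p_def ennreal_mult'[symmetric] sum_distrib_left mult_ac)
  also have "\<dots> \<le> ennreal (b * (\<Sum>I\<in>Pow {..<n}. p I * real (card I)) powr \<alpha>)"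
  proof (intro ennreal_leI mult_left_mono sum_powr_concave)
    have "(\<Sum>I\<in>Pow {..<n}. p I) = prob (\<Union>I\<in>Pow {..<n}. {\<omega>\<in>space M. V \<omega> \<in> C I})"
      unfolding p_def using ev_C VC
      by (intro finite_measure_finite_Union[symmetric]) (auto simp: disjoint_family_on_def)
    also have "(\<Union>I\<in>Pow {..<n}. {\<omega>\<in>space M. V \<omega> \<in> C I}) = space M" using VC by auto
    finally show "(\<Sum>I\<in>Pow {..<n}. p I) = 1" by (simp add: prob_space)
  qed (use b \<alpha> in \<open>auto simp: p_def\<close>)
  also have "(\<Sum>I\<in>Pow {..<n}. p I * real (card I)) = (\<Sum>i<n. prob {\<omega>\<in>space M. V \<omega> \<in> B i})"
  proof -
    have "(\<Sum>I\<in>Pow {..<n}. p I * real (card I))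
        = (\<Sum>I\<in>Pow {..<n}. \<Sum>i<n. p I * (if i \<in> I then 1 else 0))"
    proof (intro sum.cong refl)
      fix I assume "I \<in> Pow {..<n}"
      then have "{..<n} \<inter> I = I" by auto
      then show "p I * real (card I) = (\<Sum>i<n. p I * (if i \<in> I then 1 else 0))"
        by (simp add: sum_distrib_left[symmetric] sum.If_cases)
    qed
    also have "\<dots> = (\<Sum>i<n. \<Sum>I\<in>Pow {..<n}. p I * (if i \<in> I then 1 else 0))" by (rule sum.swap)
    also have "\<dots> = (\<Sum>i<n. prob {\<omega>\<in>space M. V \<omega> \<in> B i})"
    proof (intro sum.cong refl)
      fix i assume i: "i \<in> {..<n}"
      have "(\<Sum>I\<in>Pow {..<n}. p I * (if i \<in> I then 1 else 0)) = (\<Sum>I\<in>{I\<in>Pow {..<n}. i \<in> I}. p I)"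
        by (simp add: sum.inter_filter[symmetric] if_distrib cong: if_cong)
      also have "\<dots> = prob (\<Union>I\<in>{I\<in>Pow {..<n}. i \<in> I}. {\<omega>\<in>space M. V \<omega> \<in> C I})"
        unfolding p_def using ev_C VC
        by (intro finite_measure_finite_Union[symmetric]) (auto simp: disjoint_family_on_def)
      also have "(\<Union>I\<in>{I\<in>Pow {..<n}. i \<in> I}. {\<omega>\<in>space M. V \<omega> \<in> C I}) = {\<omega>\<in>space M. V \<omega> \<in> B i}"
        using VC i by auto
      finally show "(\<Sum>I\<in>Pow {..<n}. p I * (if i \<in> I then 1 else 0)) = prob {\<omega>\<in>space M. V \<omega> \<in> B i}" .
    qed
    finally show ?thesis .
  qed
  finally show ?thesis .
qed

text \<open>At each level the multipliers enter only through two random index sets, where they exceed the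
  level and where their negatives do; the factor 2 counts these two sets.\<close>

lemma multiplier_inequality:
  fixes f :: "nat \<Rightarrow> nat \<Rightarrow> 'u \<Rightarrow> real" and g :: "nat \<Rightarrow> 'v \<Rightarrow> real"
  assumes ind: "indep_elements M S U T V" and d: "d > 0" and n: "n > 0"
    and f: "\<And>i j. i < n \<Longrightarrow> j < d \<Longrightarrow> f i j \<in> borel_measurable S"
    and g: "\<And>i. i < n \<Longrightarrow> g i \<in> borel_measurable T"
    and b: "b \<ge> 0" and \<alpha>: "0 < \<alpha>" "\<alpha> \<le> 1"
    and fixed: "\<And>I. I \<subseteq> {..<n} \<Longrightarrow>
       (\<integral>\<^sup>+\<omega>. ennreal (Max ((\<lambda>j. \<bar>\<Sum>i\<in>I. f i j (U \<omega>)\<bar>) ` {..<d})) \<partial>M) \<le> ennreal (b * real (card I) powr \<alpha>)"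
  shows "(\<integral>\<^sup>+\<omega>. ennreal (Max ((\<lambda>j. \<bar>\<Sum>i<n. g i (V \<omega>) * f i j (U \<omega>)\<bar>) ` {..<d})) \<partial>M)
     \<le> ennreal (2 * b * real n powr \<alpha>) *
       (\<integral>\<^sup>+t\<in>{0..}. ennreal ((1 / real n * (\<Sum>i<n. \<P>(\<omega> in M. \<bar>g i (V \<omega>)\<bar> > t))) powr \<alpha>) \<partial>lborel)"
proof -
  have U [measurable]: "U \<in> measurable M S" and V [measurable]: "V \<in> measurable M T"
    using ind by (auto simp: indep_elements_def)
  have fU [measurable]: "(\<lambda>\<omega>. f i j (U \<omega>)) \<in> borel_measurable M" if "i < n" "j < d" for i j
    using measurable_compose[OF U f[OF that]] .
  have gV [measurable]: "(\<lambda>\<omega>. g i (V \<omega>)) \<in> borel_measurable M" if "i < n" for i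
    using measurable_compose[OF V g[OF that]] .
  define Z where "Z I \<omega> = Max ((\<lambda>j. \<bar>\<Sum>i\<in>I. f i j (U \<omega>)\<bar>) ` {..<d})" for I \<omega>
  have ne: "{..<d} \<noteq> {}" using d by auto
  define Ip where "Ip t \<omega> = {i. i < n \<and> t < g i (V \<omega>)}" for t \<omega>
  define In where "In t \<omega> = {i. i < n \<and> t < - g i (V \<omega>)}" for t \<omega>
  define H where "H t \<omega> = (ennreal (Z (Ip t \<omega>) \<omega>) + ennreal (Z (In t \<omega>) \<omega>)) * indicator {0..} t" for t \<omega>
  have Z_meas [measurable]: "(\<lambda>x. Z {i. i < n \<and> P i x} (snd x)) \<in> borel_measurable (lborel \<Otimes>\<^sub>M M)"
    if P: "\<And>i. i < n \<Longrightarrow> Measurable.pred (lborel \<Otimes>\<^sub>M M) (P i)" for P :: "nat \<Rightarrow> real \<times> 'a \<Rightarrow> bool"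
  proof -
    have "(\<lambda>x. Z {i. i < n \<and> P i x} (snd x))
        = (\<lambda>x. Max ((\<lambda>j. \<bar>\<Sum>i<n. if P i x then f i j (U (snd x)) else 0\<bar>) ` {..<d}))"
      unfolding Z_def by (intro ext arg_cong[of _ _ Max] image_cong refl arg_cong[of _ _ abs])
        (auto simp: sum.If_cases intro!: sum.cong)
    also have "\<dots> \<in> borel_measurable (lborel \<Otimes>\<^sub>M M)"
    proof (intro borel_measurable_Max borel_measurable_abs borel_measurable_sum)
      fix i j assume "i \<in> {..<n}" "j \<in> {..<d}"
      then have [measurable]: "Measurable.pred (lborel \<Otimes>\<^sub>M M) (P i)" "(\<lambda>\<omega>. f i j (U \<omega>)) \<in> borel_measurable M"
        using P fU by auto
      show "(\<lambda>x. if P i x then f i j (U (snd x)) else 0) \<in> borel_measurable (lborel \<Otimes>\<^sub>M M)"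
        by measurable
    qed auto
    finally show ?thesis .
  qed
  have H_meas: "(\<lambda>x. H (fst x) (snd x)) \<in> borel_measurable (lborel \<Otimes>\<^sub>M M)"
  proof -
    have "Measurable.pred (lborel \<Otimes>\<^sub>M M) (\<lambda>x. fst x < g i (V (snd x)))"
      "Measurable.pred (lborel \<Otimes>\<^sub>M M) (\<lambda>x. fst x < - g i (V (snd x)))" if "i < n" for i
      using measurable_compose[OF measurable_snd gV[OF that], of lborel] by measurable
    then show ?thesis unfolding H_def Ip_def In_def
      using Z_meas[of "\<lambda>i x. fst x < g i (V (snd x))"] Z_meas[of "\<lambda>i x. fst x < - g i (V (snd x))"]
      by measurable
  qed
  have layer: "ennreal (Max ((\<lambda>j. \<bar>\<Sum>i<n. g i (V \<omega>) * f i j (U \<omega>)\<bar>) ` {..<d})) \<le> (\<integral>\<^sup>+t. H t \<omega> \<partial>lborel)" for \<omega>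
  proof -
    obtain j where j: "j < d" and max: "Max ((\<lambda>j. \<bar>\<Sum>i<n. g i (V \<omega>) * f i j (U \<omega>)\<bar>) ` {..<d})
        = \<bar>\<Sum>i<n. g i (V \<omega>) * f i j (U \<omega>)\<bar>"
    proof -
      have "Max ((\<lambda>j. \<bar>\<Sum>i<n. g i (V \<omega>) * f i j (U \<omega>)\<bar>) ` {..<d})
          \<in> (\<lambda>j. \<bar>\<Sum>i<n. g i (V \<omega>) * f i j (U \<omega>)\<bar>) ` {..<d}"
        using ne by (intro Max_in) auto
      then show ?thesis using that by blast
    qed
    define \<phi> where "\<phi> t = (\<Sum>i<n. (indicator {t. 0 \<le> t \<and> t < g i (V \<omega>)} t
        - indicator {t. 0 \<le> t \<and> t < - g i (V \<omega>)} t) * f i j (U \<omega>))" for t :: real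
    have \<phi>: "has_bochner_integral lborel \<phi> (\<Sum>i<n. g i (V \<omega>) * f i j (U \<omega>))"
      unfolding \<phi>_def by (intro has_bochner_integral_sum has_bochner_integral_mult_left integral_level_sets)
    have bd: "\<bar>\<phi> t\<bar> \<le> (Z (Ip t \<omega>) \<omega> + Z (In t \<omega>) \<omega>) * indicator {0..} t" for t
    proof (cases "t \<ge> 0")
      case True
      have "\<phi> t = (\<Sum>i<n. if t < g i (V \<omega>) then f i j (U \<omega>) else 0)
                - (\<Sum>i<n. if t < - g i (V \<omega>) then f i j (U \<omega>) else 0)"
        unfolding \<phi>_def sum_subtractf[symmetric] using True
        by (intro sum.cong) (auto simp: indicator_def algebra_simps)
      also have "\<dots> = (\<Sum>i\<in>Ip t \<omega>. f i j (U \<omega>)) - (\<Sum>i\<in>In t \<omega>. f i j (U \<omega>))"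
        by (auto simp: sum.If_cases Ip_def In_def Int_def)
      finally have "\<bar>\<phi> t\<bar> \<le> \<bar>\<Sum>i\<in>Ip t \<omega>. f i j (U \<omega>)\<bar> + \<bar>\<Sum>i\<in>In t \<omega>. f i j (U \<omega>)\<bar>" by linarith
      also have "\<dots> \<le> Z (Ip t \<omega>) \<omega> + Z (In t \<omega>) \<omega>"
        unfolding Z_def using j by (intro add_mono Max_ge) auto
      finally show ?thesis using True by simp
    qed (auto simp: \<phi>_def)
    have Z0: "Z I \<omega> \<ge> 0" for I
      unfolding Z_def using j by (intro order_trans[OF _ Max_ge[of _ "\<bar>\<Sum>i\<in>I. f i j (U \<omega>)\<bar>"]]) auto
    have "ennreal \<bar>\<phi> t\<bar> \<le> H t \<omega>" for t
    proof (cases "t \<ge> 0")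
      case True
      then have "ennreal \<bar>\<phi> t\<bar> \<le> ennreal (Z (Ip t \<omega>) \<omega> + Z (In t \<omega>) \<omega>)"
        using bd[of t] by (intro ennreal_leI) simp
      then show ?thesis using True Z0 by (simp add: H_def)
    next
      case False
      then show ?thesis using bd[of t] by (simp add: H_def)
    qed
    then have "(\<integral>\<^sup>+t. ennreal (norm (\<phi> t)) \<partial>lborel) \<le> (\<integral>\<^sup>+t. H t \<omega> \<partial>lborel)"
      by (intro nn_integral_mono) auto
    moreover have "ennreal (norm (integral\<^sup>L lborel \<phi>)) \<le> (\<integral>\<^sup>+t. ennreal (norm (\<phi> t)) \<partial>lborel)"
      using \<phi> by (intro integral_norm_bound_ennreal) (auto simp: has_bochner_integral_iff)
    ultimately show ?thesis
      using max \<phi> by (simp add: has_bochner_integral_iff)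
  qed
  have level: "(\<integral>\<^sup>+\<omega>. H t \<omega> \<partial>M) \<le> ennreal (2 * b * real n powr \<alpha>) *
      (ennreal ((1 / real n * (\<Sum>i<n. \<P>(\<omega> in M. \<bar>g i (V \<omega>)\<bar> > t))) powr \<alpha>) * indicator {0..} t)" for t
  proof (cases "t \<ge> 0")
    case True
    let ?s = "\<Sum>i<n. \<P>(\<omega> in M. \<bar>g i (V \<omega>)\<bar> > t)"
    have one: "(\<integral>\<^sup>+\<omega>. ennreal (Z {i. i < n \<and> t < c * g i (V \<omega>)} \<omega>) \<partial>M) \<le> ennreal (b * ?s powr \<alpha>)"
      if c: "c = 1 \<or> c = - 1" for c :: real
    proof -
      have B: "{v\<in>space T. t < c * g i v} \<in> sets T" if "i < n" for i
        using g[OF that] by measurable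
      have eq: "V \<omega> \<in> {v\<in>space T. t < c * g i v} \<longleftrightarrow> t < c * g i (V \<omega>)" if "\<omega> \<in> space M" for \<omega> i
        using measurable_space[OF V that] by auto
      have "(\<integral>\<^sup>+\<omega>. ennreal (Z {i. i < n \<and> t < c * g i (V \<omega>)} \<omega>) \<partial>M)
         = (\<integral>\<^sup>+\<omega>. ennreal (Z {i. i < n \<and> V \<omega> \<in> {v\<in>space T. t < c * g i v}} \<omega>) \<partial>M)"
        using eq by (intro nn_integral_cong) simp
      also have "\<dots> \<le> ennreal (b * (\<Sum>i<n. prob {\<omega>\<in>space M. V \<omega> \<in> {v\<in>space T. t < c * g i v}}) powr \<alpha>)"
        unfolding Z_def by (rule nn_integral_random_index_set[OF ind f B b \<alpha> fixed])
      also have "\<dots> \<le> ennreal (b * ?s powr \<alpha>)"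
      proof (intro ennreal_leI mult_left_mono powr_mono2 sum_mono sum_nonneg)
        fix i assume "i \<in> {..<n}"
        then show "prob {\<omega>\<in>space M. V \<omega> \<in> {v\<in>space T. t < c * g i v}} \<le> \<P>(\<omega> in M. \<bar>g i (V \<omega>)\<bar> > t)"
          using c eq gV[of i] by (intro finite_measure_mono) auto
      qed (use \<alpha> b in auto)
      finally show ?thesis .
    qed
    have m: "(\<lambda>\<omega>. Z (Ip t \<omega>) \<omega>) \<in> borel_measurable M" "(\<lambda>\<omega>. Z (In t \<omega>) \<omega>) \<in> borel_measurable M"
    proof -
      have "Measurable.pred (lborel \<Otimes>\<^sub>M M) (\<lambda>x. t < g i (V (snd x)))"
        "Measurable.pred (lborel \<Otimes>\<^sub>M M) (\<lambda>x. t < - g i (V (snd x)))" if "i < n" for i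
        using measurable_compose[OF measurable_snd gV[OF that], of lborel] by measurable
      then show "(\<lambda>\<omega>. Z (Ip t \<omega>) \<omega>) \<in> borel_measurable M" "(\<lambda>\<omega>. Z (In t \<omega>) \<omega>) \<in> borel_measurable M"
        using measurable_compose[OF measurable_Pair1'[of t lborel M], OF _ Z_meas[of "\<lambda>i x. t < g i (V (snd x))"]]
          measurable_compose[OF measurable_Pair1'[of t lborel M], OF _ Z_meas[of "\<lambda>i x. t < - g i (V (snd x))"]]
        by (simp_all add: Ip_def In_def)
    qed
    have "(\<integral>\<^sup>+\<omega>. H t \<omega> \<partial>M) = (\<integral>\<^sup>+\<omega>. ennreal (Z (Ip t \<omega>) \<omega>) \<partial>M) + (\<integral>\<^sup>+\<omega>. ennreal (Z (In t \<omega>) \<omega>) \<partial>M)"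
      using True m by (simp add: H_def nn_integral_add)
    also have "\<dots> \<le> ennreal (b * ?s powr \<alpha>) + ennreal (b * ?s powr \<alpha>)"
      using one[of 1] one[of "-1"] by (intro add_mono) (simp_all add: Ip_def In_def)
    also have "\<dots> = ennreal (2 * b * ?s powr \<alpha>)" using b by (simp add: ennreal_plus[symmetric] del: ennreal_plus)
    also have "?s = real n * (1 / real n * ?s)" using n by simp
    also have "2 * b * (real n * (1 / real n * ?s)) powr \<alpha> = (2 * b * real n powr \<alpha>) * (1 / real n * ?s) powr \<alpha>"
      by (subst powr_mult) (auto intro!: sum_nonneg divide_nonneg_nonneg)
    finally show ?thesis using True b by (simp add: ennreal_mult')
  qed (simp add: H_def)
  interpret pair_sigma_finite lborel M ..
  have s_meas [measurable]: "(\<lambda>t. \<P>(\<omega> in M. \<bar>g i (V \<omega>)\<bar> > t)) \<in> borel_measurable borel" if "i < n" for i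
  proof -
    have "antimono (\<lambda>t. \<P>(\<omega> in M. \<bar>g i (V \<omega>)\<bar> > t))"
      using gV[OF that] by (intro antimonoI finite_measure_mono) auto
    then have "(\<lambda>t. - (- \<P>(\<omega> in M. \<bar>g i (V \<omega>)\<bar> > t))) \<in> borel_measurable borel"
      by (intro borel_measurable_uminus borel_measurable_mono) (auto simp: mono_def antimono_def)
    then show ?thesis by simp
  qed
  have "(\<integral>\<^sup>+\<omega>. ennreal (Max ((\<lambda>j. \<bar>\<Sum>i<n. g i (V \<omega>) * f i j (U \<omega>)\<bar>) ` {..<d})) \<partial>M)
      \<le> (\<integral>\<^sup>+\<omega>. \<integral>\<^sup>+t. H t \<omega> \<partial>lborel \<partial>M)" by (intro nn_integral_mono layer)
  also have "\<dots> = (\<integral>\<^sup>+t. \<integral>\<^sup>+\<omega>. H t \<omega> \<partial>M \<partial>lborel)"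
    using H_meas by (intro Fubini') (simp add: case_prod_beta')
  also have "\<dots> \<le> (\<integral>\<^sup>+t. ennreal (2 * b * real n powr \<alpha>) *
      (ennreal ((1 / real n * (\<Sum>i<n. \<P>(\<omega> in M. \<bar>g i (V \<omega>)\<bar> > t))) powr \<alpha>) * indicator {0..} t) \<partial>lborel)"
    by (intro nn_integral_mono level)
  also have "\<dots> = ennreal (2 * b * real n powr \<alpha>) *
       (\<integral>\<^sup>+t\<in>{0..}. ennreal ((1 / real n * (\<Sum>i<n. \<P>(\<omega> in M. \<bar>g i (V \<omega>)\<bar> > t))) powr \<alpha>) \<partial>lborel)"
    by (intro nn_integral_cmult) measurable
  finally show ?thesis .
qed

end

section \<open>Tail of the noise correlation and the prediction error\<close>

context prob_space
begin

text \<open>The Lebesgue integral of a function that is not integrable is 0, so the entries of the mean Gram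
  matrix are second moments only once square integrability is known. It is derived from the finite
  fourth moment.\<close>

lemma square_integrable_of_Max_fourth:
  fixes y :: "nat \<Rightarrow> 'a \<Rightarrow> real"
  assumes y: "\<And>j. j < d \<Longrightarrow> random_variable borel (y j)" and j: "j < d"
    and fin: "(\<integral>\<^sup>+\<omega>. ennreal (Max ((\<lambda>j. \<bar>y j \<omega>\<bar> ^ 4) ` {..<d})) \<partial>M) < \<infinity>"
  shows "integrable M (\<lambda>\<omega>. (y j \<omega>)\<^sup>2)"
proof (rule integrableI_bounded)
  have le: "(y j \<omega>)\<^sup>2 \<le> 1 + Max ((\<lambda>j. \<bar>y j \<omega>\<bar> ^ 4) ` {..<d})" for \<omega>
  proof -
    have "(y j \<omega>)\<^sup>2 \<le> 1 + ((y j \<omega>)\<^sup>2)\<^sup>2"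
      using sum_power2_ge_zero[of "(y j \<omega>)\<^sup>2 - 1" 0] by (simp add: power2_diff) (smt (verit) zero_le_power2)
    also have "((y j \<omega>)\<^sup>2)\<^sup>2 = \<bar>y j \<omega>\<bar> ^ 4" by (simp add: power_even_abs flip: power_mult)
    also have "\<bar>y j \<omega>\<bar> ^ 4 \<le> Max ((\<lambda>j. \<bar>y j \<omega>\<bar> ^ 4) ` {..<d})" using j by (intro Max_ge) auto
    finally show ?thesis by simp
  qed
  have "(\<integral>\<^sup>+\<omega>. ennreal (norm ((y j \<omega>)\<^sup>2)) \<partial>M)
      \<le> (\<integral>\<^sup>+\<omega>. 1 + ennreal (Max ((\<lambda>j. \<bar>y j \<omega>\<bar> ^ 4) ` {..<d})) \<partial>M)"
  proof (intro nn_integral_mono)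
    fix \<omega>
    have "0 \<le> \<bar>y j \<omega>\<bar> ^ 4" by simp
    also have "\<dots> \<le> Max ((\<lambda>j. \<bar>y j \<omega>\<bar> ^ 4) ` {..<d})" using j by (intro Max_ge) auto
    finally have "ennreal (1 + Max ((\<lambda>j. \<bar>y j \<omega>\<bar> ^ 4) ` {..<d})) = 1 + ennreal (Max ((\<lambda>j. \<bar>y j \<omega>\<bar> ^ 4) ` {..<d}))"
      by simp
    then show "ennreal (norm ((y j \<omega>)\<^sup>2)) \<le> 1 + ennreal (Max ((\<lambda>j. \<bar>y j \<omega>\<bar> ^ 4) ` {..<d}))"
      using ennreal_leI[OF le[of \<omega>]] by simp
  qed
  also have "\<dots> = 1 + (\<integral>\<^sup>+\<omega>. ennreal (Max ((\<lambda>j. \<bar>y j \<omega>\<bar> ^ 4) ` {..<d})) \<partial>M)"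
    using y by (subst nn_integral_add)
      (auto simp: emeasure_space_1 intro!: measurable_compose[OF _ measurable_ennreal] borel_measurable_Max)
  also have "\<dots> < \<infinity>" using fin by (simp add: ennreal_add_less_top)
  finally show "(\<integral>\<^sup>+\<omega>. ennreal (norm ((y j \<omega>)\<^sup>2)) \<partial>M) < \<infinity>" .
qed (use y[OF j] in measurable)

text \<open>Equality in law transfers the moments of the first row to every row, so that each second moment is the
  average over the rows, a diagonal entry of the mean Gram matrix.\<close>

lemma iid_rows_moments:
  fixes X :: "'a \<Rightarrow> real mat"
  assumes design: "\<And>\<omega>. \<omega> \<in> space M \<Longrightarrow> X \<omega> \<in> carrier_mat n d" and n: "n > 0"
    and iid: "iid_rows M n d X" and fin: "fourth_moment M d X < \<infinity>" and i: "i < n"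
  shows "(\<integral>\<^sup>+\<omega>. ennreal (Max ((\<lambda>j. \<bar>row (X \<omega>) i $ j\<bar> ^ 4) ` {..<d})) \<partial>M) = fourth_moment M d X"
    and "j < d \<Longrightarrow> integrable M (\<lambda>\<omega>. (row (X \<omega>) i $ j)\<^sup>2)"
    and "j < d \<Longrightarrow> expectation (\<lambda>\<omega>. (row (X \<omega>) i $ j)\<^sup>2) \<le> Max (singular_values (gram_mean M n d X))"
proof -
  let ?P = "Pi\<^sub>M {..<d} (\<lambda>_. borel :: real measure)"
  let ?r = "\<lambda>i \<omega>. coords d (row (X \<omega>) i)"
  have r [measurable]: "?r i \<in> measurable M ?P" if "i < n" for i
    using iid that by (auto simp: iid_rows_def indep_vars_def)
  have law: "distr M ?P (?r i) = distr M ?P (?r 0)" if "i < n" for i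
    using iid that unfolding iid_rows_def by blast
  have comp [measurable]: "(\<lambda>u. u j) \<in> borel_measurable ?P" if "j < d" for j
    using that by (intro measurable_component_singleton) auto
  have coord: "?r i \<omega> j = row (X \<omega>) i $ j" if "j < d" for i j \<omega> using that by simp
  have x_rv: "random_variable borel (\<lambda>\<omega>. row (X \<omega>) i $ j)" if "i < n" "j < d" for i j
    using measurable_compose[OF r[OF that(1)] comp[OF that(2)]] that(2) by simp
  define H where "H u = ennreal (Max ((\<lambda>j. \<bar>u j\<bar> ^ 4) ` {..<d}))" for u :: "nat \<Rightarrow> real"
  have H: "H \<in> borel_measurable ?P"
    unfolding H_def by (intro measurable_compose[OF _ measurable_ennreal] borel_measurable_Max
      borel_measurable_power borel_measurable_abs comp) auto
  have Hr: "H (?r i \<omega>) = ennreal (Max ((\<lambda>j. \<bar>row (X \<omega>) i $ j\<bar> ^ 4) ` {..<d}))" for i \<omega>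
    unfolding H_def by (intro arg_cong[of _ _ ennreal] arg_cong[of _ _ Max] image_cong) auto
  have fourth: "(\<integral>\<^sup>+\<omega>. ennreal (Max ((\<lambda>j. \<bar>row (X \<omega>) i $ j\<bar> ^ 4) ` {..<d})) \<partial>M) = fourth_moment M d X"
    if i: "i < n" for i
  proof -
    have "(\<integral>\<^sup>+\<omega>. H (?r i \<omega>) \<partial>M) = (\<integral>\<^sup>+u. H u \<partial>distr M ?P (?r i))"
      using r[OF i] H by (simp add: nn_integral_distr)
    also have "\<dots> = (\<integral>\<^sup>+\<omega>. H (?r 0 \<omega>) \<partial>M)"
      unfolding law[OF i] using r[OF n] H by (simp add: nn_integral_distr)
    finally have "(\<integral>\<^sup>+\<omega>. ennreal (Max ((\<lambda>j. \<bar>row (X \<omega>) i $ j\<bar> ^ 4) ` {..<d})) \<partial>M)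
       = (\<integral>\<^sup>+\<omega>. ennreal (Max ((\<lambda>j. \<bar>row (X \<omega>) 0 $ j\<bar> ^ 4) ` {..<d})) \<partial>M)" by (simp only: Hr)
    also have "\<dots> = fourth_moment M d X"
      unfolding fourth_moment_def using design n
      by (intro nn_integral_cong arg_cong[of _ _ ennreal] arg_cong[of _ _ Max] image_cong)
        (auto dest!: design)
    finally show ?thesis .
  qed
  then show "(\<integral>\<^sup>+\<omega>. ennreal (Max ((\<lambda>j. \<bar>row (X \<omega>) i $ j\<bar> ^ 4) ` {..<d})) \<partial>M) = fourth_moment M d X"
    using i by blast
  have sq: "integrable M (\<lambda>\<omega>. (row (X \<omega>) i $ j)\<^sup>2)" if "i < n" "j < d" for i j
    by (rule square_integrable_of_Max_fourth[OF x_rv[OF that(1)] that(2)])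
      (simp_all only: fourth[OF that(1)] fin)
  then show "j < d \<Longrightarrow> integrable M (\<lambda>\<omega>. (row (X \<omega>) i $ j)\<^sup>2)" using i by blast
  show "expectation (\<lambda>\<omega>. (row (X \<omega>) i $ j)\<^sup>2) \<le> Max (singular_values (gram_mean M n d X))" if j: "j < d"
  proof -
    have same: "expectation (\<lambda>\<omega>. (row (X \<omega>) i' $ j)\<^sup>2) = expectation (\<lambda>\<omega>. (row (X \<omega>) 0 $ j)\<^sup>2)"
      if i': "i' < n" for i'
    proof -
      have m: "(\<lambda>u. (u j)\<^sup>2) \<in> borel_measurable ?P" using comp[OF j] by measurable
      have "expectation (\<lambda>\<omega>. (?r i' \<omega> j)\<^sup>2) = integral\<^sup>L (distr M ?P (?r i')) (\<lambda>u. (u j)\<^sup>2)"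
        by (rule integral_distr[OF r[OF i'] m, symmetric])
      also have "\<dots> = expectation (\<lambda>\<omega>. (?r 0 \<omega> j)\<^sup>2)"
        unfolding law[OF i'] by (rule integral_distr[OF r[OF n] m])
      finally show ?thesis using j by simp
    qed
    have "gram_mean M n d X $$ (j, j) = expectation (\<lambda>\<omega>. (\<Sum>i'<n. (row (X \<omega>) i' $ j)\<^sup>2) / real n)"
      unfolding gram_mean_def using j
      by (auto simp: scalar_prod_def lessThan_atLeast0 power2_eq_square intro!: Bochner_Integration.integral_cong sum.cong
           arg_cong2[of _ _ _ _ "(/)"] dest!: design)
    also have "\<dots> = (\<Sum>i'<n. expectation (\<lambda>\<omega>. (row (X \<omega>) i' $ j)\<^sup>2)) / real n"
      using sq j by (simp add: Bochner_Integration.integral_sum)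
    also have "\<dots> = (\<Sum>i'<n. expectation (\<lambda>\<omega>. (row (X \<omega>) 0 $ j)\<^sup>2)) / real n"
      by (intro arg_cong2[of _ _ _ _ "(/)"] sum.cong same) auto
    also have "\<dots> = expectation (\<lambda>\<omega>. (row (X \<omega>) 0 $ j)\<^sup>2)" using n by simp
    also have "\<dots> = expectation (\<lambda>\<omega>. (row (X \<omega>) i $ j)\<^sup>2)" by (rule same[OF i, symmetric])
    finally show ?thesis
      using diagonal_le_Max_singular_value[of "gram_mean M n d X" d j] j by (simp add: gram_mean_def)
  qed
qed

text \<open>Markov's inequality, with the multiplier inequality bounding the expected maximum. If the noise norm is 0 the
  threshold vanishes, but then the expected maximum is 0 as well and the event is null.\<close>

lemma score_tail_bound:
  fixes X :: "'a \<Rightarrow> real mat" and \<xi> :: "'a \<Rightarrow> real vec"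
  assumes n: "n > 0" and d: "d \<ge> 2"
    and design: "\<And>\<omega>. \<omega> \<in> space M \<Longrightarrow> X \<omega> \<in> carrier_mat n d"
    and iid: "iid_rows M n d X"
    and mean: "\<And>i j. i < n \<Longrightarrow> j < d \<Longrightarrow> mean_zero M (\<lambda>\<omega>. X \<omega> $$ (i, j))"
    and indep: "indep_design_noise M n d X \<xi>"
    and v: "v > 0" "Max (singular_values (gram_mean M n d X)) \<le> v"
    and K: "K > 0" "fourth_moment M d X \<le> ennreal (K * real n powr (2 - 4 * \<alpha>) / ln (real d))"
    and \<alpha>: "1 / 4 \<le> \<alpha>" "\<alpha> \<le> 1 / 2"
    and N: "N \<ge> 0" "noise_norm M n \<alpha> \<xi> = ennreal N" and L: "L > 0"
  defines "bad \<equiv> {\<omega> \<in> space M. \<exists>j<d. real n * (2 * L * N * sqrt (ln (real d) / real n))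
                                         < 4 * \<bar>\<Sum>i<n. \<xi> \<omega> $ i * X \<omega> $$ (i, j)\<bar>}"
  shows "bad \<in> events" and "prob bad \<le> 4 * (4 * K powr (1 / 4) + 3 * sqrt v) / L"
proof -
  define D where "D = ln (real d)"
  have D: "D > 0" using d by (simp add: D_def)
  define C where "C = 4 * K powr (1 / 4) + 3 * sqrt v"
  have C: "C > 0" using K v by (simp add: C_def add_pos_pos)
  define b where "b = C * sqrt D * real n powr (1 / 2 - \<alpha>)"
  have b: "b \<ge> 0" using C D by (simp add: b_def)
  have F: "fourth_moment M d X < \<infinity>" using K(2) by (rule le_less_trans) simp
  have mom: "(\<integral>\<^sup>+\<omega>. ennreal (Max ((\<lambda>j. \<bar>row (X \<omega>) i $ j\<bar> ^ 4) ` {..<d})) \<partial>M) = fourth_moment M d X"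
    "j < d \<Longrightarrow> integrable M (\<lambda>\<omega>. (row (X \<omega>) i $ j)\<^sup>2)"
    "j < d \<Longrightarrow> expectation (\<lambda>\<omega>. (row (X \<omega>) i $ j)\<^sup>2) \<le> Max (singular_values (gram_mean M n d X))"
    if "i < n" for i j
    by (rule iid_rows_moments[OF design n iid F that]; assumption)+
  have row_eq: "row (X \<omega>) i $ j = X \<omega> $$ (i, j)" if "\<omega> \<in> space M" "i < n" "j < d" for \<omega> i j
    using design[OF that(1)] that by auto
  have ind: "indep_elements M (Pi\<^sub>M ({..<n} \<times> {..<d}) (\<lambda>_. borel)) (\<lambda>\<omega>. entries n d (X \<omega>))
       (Pi\<^sub>M {..<n} (\<lambda>_. borel)) (\<lambda>\<omega>. coords n (\<xi> \<omega>))"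
    using indep by (simp add: indep_design_noise_def)
  have fixed: "(\<integral>\<^sup>+\<omega>. ennreal (Max ((\<lambda>j. \<bar>\<Sum>i\<in>I. entries n d (X \<omega>) (i, j)\<bar>) ` {..<d})) \<partial>M)
      \<le> ennreal (b * real (card I) powr \<alpha>)" if I: "I \<subseteq> {..<n}" for I
  proof -
    have "(\<integral>\<^sup>+\<omega>. ennreal (Max ((\<lambda>j. \<bar>\<Sum>i\<in>I. entries n d (X \<omega>) (i, j)\<bar>) ` {..<d})) \<partial>M)
       = (\<integral>\<^sup>+\<omega>. ennreal (Max ((\<lambda>j. \<bar>\<Sum>i\<in>I. row (X \<omega>) i $ j\<bar>) ` {..<d})) \<partial>M)"
      using I by (intro nn_integral_cong arg_cong[of _ _ ennreal] arg_cong[of _ _ Max] image_cong refl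
        arg_cong[of _ _ abs] sum.cong) (auto simp: row_eq subset_iff)
    also have "\<dots> \<le> ennreal ((4 * K powr (1 / 4) + 3 * sqrt v) * sqrt (ln (real d))
        * real n powr (1 / 2 - \<alpha>) * real (card I) powr \<alpha>)"
    proof (rule expectation_Max_abs_sum_rows_le[OF d I _ _ _ _ _ v(1) K(1) \<alpha>])
      show "indep_vars (\<lambda>_. Pi\<^sub>M {..<d} (\<lambda>_. borel)) (\<lambda>i \<omega>. \<lambda>j\<in>{..<d}. row (X \<omega>) i $ j) {..<n}"
        using iid by (simp add: iid_rows_def)
      fix i assume i: "i < n"
      show "(\<integral>\<^sup>+\<omega>. ennreal (Max ((\<lambda>j. \<bar>row (X \<omega>) i $ j\<bar> ^ 4) ` {..<d})) \<partial>M)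
          \<le> ennreal (K * real n powr (2 - 4 * \<alpha>) / ln (real d))"
        using mom(1)[OF i] K(2) by simp
      fix j assume j: "j < d"
      have "integrable M (\<lambda>\<omega>. row (X \<omega>) i $ j) = integrable M (\<lambda>\<omega>. X \<omega> $$ (i, j))"
        "expectation (\<lambda>\<omega>. row (X \<omega>) i $ j) = expectation (\<lambda>\<omega>. X \<omega> $$ (i, j))"
        using row_eq i j by (auto intro!: Bochner_Integration.integrable_cong Bochner_Integration.integral_cong)
      then show "mean_zero M (\<lambda>\<omega>. row (X \<omega>) i $ j)" using mean[OF i j] by (simp add: mean_zero_def)
      show "integrable M (\<lambda>\<omega>. (row (X \<omega>) i $ j)\<^sup>2)" by (rule mom(2)[OF i j])
      show "expectation (\<lambda>\<omega>. (row (X \<omega>) i $ j)\<^sup>2) \<le> v" using mom(3)[OF i j] v(2) by linarith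
    qed
    finally show ?thesis by (simp add: b_def C_def D_def)
  qed
  define Z where "Z \<omega> = Max ((\<lambda>j. \<bar>\<Sum>i<n. coords n (\<xi> \<omega>) i * entries n d (X \<omega>) (i, j)\<bar>) ` {..<d})" for \<omega>
  have Z_eq: "Z \<omega> = Max ((\<lambda>j. \<bar>\<Sum>i<n. \<xi> \<omega> $ i * X \<omega> $$ (i, j)\<bar>) ` {..<d})" for \<omega>
    unfolding Z_def by (intro arg_cong[of _ _ Max] image_cong refl arg_cong[of _ _ abs] sum.cong) auto
  have U: "(\<lambda>\<omega>. entries n d (X \<omega>)) \<in> measurable M (Pi\<^sub>M ({..<n} \<times> {..<d}) (\<lambda>_. borel))"
    and V: "(\<lambda>\<omega>. coords n (\<xi> \<omega>)) \<in> measurable M (Pi\<^sub>M {..<n} (\<lambda>_. borel))"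
    using ind unfolding indep_elements_def by blast+
  have xi_rv: "(\<lambda>\<omega>. coords n (\<xi> \<omega>) i) \<in> borel_measurable M" if "i < n" for i
    by (rule measurable_compose[OF V measurable_component_singleton]) (use that in simp)
  have X_rv: "(\<lambda>\<omega>. entries n d (X \<omega>) (i, j)) \<in> borel_measurable M" if "i < n" "j < d" for i j
    by (rule measurable_compose[OF U measurable_component_singleton]) (use that in simp)
  have Z_rv [measurable]: "Z \<in> borel_measurable M"
    unfolding Z_def using xi_rv X_rv
    by (intro borel_measurable_Max borel_measurable_abs borel_measurable_sum borel_measurable_times) auto
  have noise_eq: "(\<integral>\<^sup>+t\<in>{0..}. ennreal ((1 / real n * (\<Sum>i<n. \<P>(\<omega> in M. \<bar>coords n (\<xi> \<omega>) i\<bar> > t))) powr \<alpha>) \<partial>lborel)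
      = ennreal N"
    unfolding N(2)[symmetric] noise_norm_def by (simp cong: sum.cong_simp)
  have "(\<integral>\<^sup>+\<omega>. ennreal (Z \<omega>) \<partial>M) \<le> ennreal (2 * b * real n powr \<alpha>) * ennreal N"
    unfolding Z_def noise_eq[symmetric]
    using d n b \<alpha> fixed
    by (intro multiplier_inequality[OF ind, where f = "\<lambda>i j u. u (i, j)" and g = "\<lambda>i v. v i"])
      (auto intro!: measurable_component_singleton)
  also have "\<dots> = ennreal (2 * C * sqrt D * sqrt (real n) * N)"
  proof -
    have "real n powr (1 / 2 - \<alpha>) * real n powr \<alpha> = sqrt (real n)"
      using n by (simp add: powr_add[symmetric] powr_half_sqrt)
    then have "2 * b * real n powr \<alpha> = 2 * C * sqrt D * sqrt (real n)"
      by (simp add: b_def mult.assoc)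
    then show ?thesis using N(1) by (simp only: ennreal_mult'')
  qed
  finally have EZ: "(\<integral>\<^sup>+\<omega>. ennreal (Z \<omega>) \<partial>M) \<le> ennreal (2 * C * sqrt D * sqrt (real n) * N)" .
  define a where "a = L / 2 * N * sqrt D * sqrt (real n)"
  have a0: "a \<ge> 0" using L N D by (simp add: a_def)
  have thr: "real n * (2 * L * N * sqrt (ln (real d) / real n)) = 4 * a"
    using n by (simp add: a_def D_def[symmetric] real_sqrt_divide field_simps)
  have bad_eq: "bad = {\<omega> \<in> space M. a < Z \<omega>}"
    unfolding bad_def thr Z_eq using d by (subst Max_gr_iff) (auto simp: lessThan_empty_iff)
  show bad: "bad \<in> events" unfolding bad_eq by measurable
  show "prob bad \<le> 4 * (4 * K powr (1 / 4) + 3 * sqrt v) / L"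
  proof (cases "N = 0")
    case True
    then have "(\<integral>\<^sup>+\<omega>. ennreal (Z \<omega>) \<partial>M) = 0" using EZ by simp
    then have "AE \<omega> in M. ennreal (Z \<omega>) = 0" by (subst (asm) nn_integral_0_iff_AE) auto
    then have "AE \<omega> in M. \<not> a < Z \<omega>" using True by (auto simp: a_def ennreal_eq_0_iff)
    then have "prob bad = 0" unfolding bad_eq by (subst prob_eq_0) auto
    then show ?thesis using C L by (simp add: C_def)
  next
    case False
    then have a: "a > 0" using L N D n by (simp add: a_def)
    have "emeasure M {\<omega> \<in> space M. 1 \<le> ennreal (1 / a) * ennreal (Z \<omega>)}
        \<le> ennreal (1 / a) * (\<integral>\<^sup>+\<omega>. ennreal (Z \<omega>) * indicator (space M) \<omega> \<partial>M)"
      by (rule nn_integral_Markov_inequality) measurable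
    moreover have "emeasure M bad \<le> emeasure M {\<omega> \<in> space M. 1 \<le> ennreal (1 / a) * ennreal (Z \<omega>)}"
    proof (rule emeasure_mono)
      show "bad \<subseteq> {\<omega> \<in> space M. 1 \<le> ennreal (1 / a) * ennreal (Z \<omega>)}"
        unfolding bad_eq using a by (auto simp: ennreal_mult'[symmetric] field_simps)
    qed measurable
    moreover have "(\<integral>\<^sup>+\<omega>. ennreal (Z \<omega>) * indicator (space M) \<omega> \<partial>M) = (\<integral>\<^sup>+\<omega>. ennreal (Z \<omega>) \<partial>M)"
      by (intro nn_integral_cong) simp
    ultimately have "emeasure M bad \<le> ennreal (1 / a) * (\<integral>\<^sup>+\<omega>. ennreal (Z \<omega>) \<partial>M)" by simp
    also have "\<dots> \<le> ennreal (1 / a) * ennreal (2 * C * sqrt D * sqrt (real n) * N)"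
      by (intro mult_left_mono EZ) auto
    also have "\<dots> = ennreal (4 * C / L)"
    proof -
      have "1 / a * (2 * C * sqrt D * sqrt (real n) * N) = 4 * C / L"
        using False L D n by (simp add: a_def field_simps)
      then show ?thesis using a by (simp add: ennreal_mult'[symmetric] del: times_divide_eq_left)
    qed
    finally show ?thesis using C L by (simp add: emeasure_eq_measure C_def ennreal_le_iff)
  qed
qed

end

lemma lasso_estimator_minimizes:
  assumes est: "lasso_estimator est" and A: "A \<in> carrier_mat n d" and y: "y \<in> carrier_vec n"
    and u: "u \<in> carrier_vec d"
  shows "est l A y \<in> carrier_vec d" "lasso_objective A y l (est l A y) \<le> lasso_objective A y l u"
proof -
  have "dim_vec y = dim_row A" "dim_col A = d" using A y by auto
  then have "is_arg_min (lasso_objective A y l) (\<lambda>\<theta>. \<theta> \<in> carrier_vec d) (est l A y)"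
    using est unfolding lasso_estimator_def by metis
  then show "est l A y \<in> carrier_vec d" "lasso_objective A y l (est l A y) \<le> lasso_objective A y l u"
    using u by (auto simp: is_arg_min_def not_less)
qed

text \<open>The constant does not depend on the parameter, the sparsity or the dimensions, which makes the
  bound uniform over sparse parameters. If the noise norm is infinite the bound on the error is
  infinite, unless \<open>s = 0\<close>; then the true parameter is zero, and so is the estimator because the
  infinite penalty admits only the zero vector.\<close>

lemma (in prob_space) lasso_error_probability:
  fixes X :: "'a \<Rightarrow> real mat" and \<xi> :: "'a \<Rightarrow> real vec"
  assumes n: "n > 0" and d: "d \<ge> 2"
    and design: "\<And>\<omega>. \<omega> \<in> space M \<Longrightarrow> X \<omega> \<in> carrier_mat n d"
    and noise: "\<And>\<omega>. \<omega> \<in> space M \<Longrightarrow> \<xi> \<omega> \<in> carrier_vec n"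
    and iid: "iid_rows M n d X"
    and mean: "\<And>i j. i < n \<Longrightarrow> j < d \<Longrightarrow> mean_zero M (\<lambda>\<omega>. X \<omega> $$ (i, j))"
    and indep: "indep_design_noise M n d X \<xi>"
    and v: "v > 0" "Max (singular_values (gram_mean M n d X)) \<le> v"
    and K: "K > 0" "fourth_moment M d X \<le> ennreal (K * real n powr (2 - 4 * \<alpha>) / ln (real d))"
    and \<alpha>: "1 / 4 \<le> \<alpha>" "\<alpha> \<le> 1 / 2"
    and c: "c > 0" and L: "L > 0" and est: "lasso_estimator est"
    and \<theta>: "\<theta> \<in> sparse_vecs d s"
  defines "good \<equiv> {\<omega> \<in> space M. \<forall>S. S \<subseteq> {..<d} \<longrightarrow> S \<noteq> {} \<longrightarrow> card S \<le> s \<longrightarrow> compatibility (X \<omega>) 3 S \<ge> c}"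
  assumes good: "good \<in> events"
  shows "\<P>(\<omega> in M. ennreal (1 / real n * (l2_norm (X \<omega> *\<^sub>v
              (est (ennreal (2 * L) * noise_norm M n \<alpha> \<xi> * ennreal (sqrt (ln (real d) / real n)))
                   (X \<omega>) (X \<omega> *\<^sub>v \<theta> + \<xi> \<omega>) - \<theta>)))\<^sup>2)
          > ennreal (16 * L\<^sup>2) * (noise_norm M n \<alpha> \<xi>)\<^sup>2 / ennreal (c\<^sup>2) *
            ennreal (real s * ln (real d) / real n))
      \<le> 4 * (4 * K powr (1 / 4) + 3 * sqrt v) / L + (1 - prob good)" (is "prob ?ev \<le> _")
proof -
  define D where "D = ln (real d)"
  have D: "D > 0" using d by (simp add: D_def)
  have \<theta>d: "\<theta> \<in> carrier_vec d" and card_S: "card {j. j < d \<and> \<theta> $ j \<noteq> 0} \<le> s"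
    using \<theta> by (auto simp: sparse_vecs_def)
  have rhs0: "0 \<le> 4 * (4 * K powr (1 / 4) + 3 * sqrt v) / L + (1 - prob good)"
    using L v by (intro add_nonneg_nonneg divide_nonneg_nonneg mult_nonneg_nonneg) auto
  define l where "l = ennreal (2 * L) * noise_norm M n \<alpha> \<xi> * ennreal (sqrt (D / real n))"
  define u where "u \<omega> = est l (X \<omega>) (X \<omega> *\<^sub>v \<theta> + \<xi> \<omega>)" for \<omega>
  have u: "u \<omega> \<in> carrier_vec d"
    "lasso_objective (X \<omega>) (X \<omega> *\<^sub>v \<theta> + \<xi> \<omega>) l (u \<omega>) \<le> lasso_objective (X \<omega>) (X \<omega> *\<^sub>v \<theta> + \<xi> \<omega>) l w"
    if "\<omega> \<in> space M" "w \<in> carrier_vec d" for \<omega> w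
  proof -
    have "X \<omega> *\<^sub>v \<theta> + \<xi> \<omega> \<in> carrier_vec n"
      by (rule add_carrier_vec[OF mult_mat_vec_carrier[OF design[OF that(1)] \<theta>d] noise[OF that(1)]])
    then show "u \<omega> \<in> carrier_vec d"
      "lasso_objective (X \<omega>) (X \<omega> *\<^sub>v \<theta> + \<xi> \<omega>) l (u \<omega>) \<le> lasso_objective (X \<omega>) (X \<omega> *\<^sub>v \<theta> + \<xi> \<omega>) l w"
      unfolding u_def by (rule lasso_estimator_minimizes[OF est design[OF that(1)] _ that(2)])+
  qed
  have ev: "?ev = {\<omega> \<in> space M. ennreal (16 * L\<^sup>2) * (noise_norm M n \<alpha> \<xi>)\<^sup>2 / ennreal (c\<^sup>2) *
            ennreal (real s * D / real n) < ennreal (1 / real n * (l2_norm (X \<omega> *\<^sub>v (u \<omega> - \<theta>)))\<^sup>2)}"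
    by (simp add: l_def u_def D_def)
  show ?thesis
  proof (cases "noise_norm M n \<alpha> \<xi>")
    case top
    have "?ev = {}"
    proof (cases "s = 0")
      case False
      then have "ennreal (16 * L\<^sup>2) * (noise_norm M n \<alpha> \<xi>)\<^sup>2 / ennreal (c\<^sup>2) * ennreal (real s * D / real n) = \<infinity>"
        using top L D n c by (simp add: ennreal_mult_eq_top_iff ennreal_top_mult ennreal_mult_top ennreal_top_divide power2_eq_square)
      then show ?thesis by (simp only: ev) simp
    next
      case True
      have l_top: "l = \<infinity>" using top L D n by (simp add: l_def ennreal_mult_top ennreal_top_mult)
      have \<theta>0: "\<theta> = 0\<^sub>v d" using True card_S \<theta>d by (intro eq_vecI) auto
      have "u \<omega> = \<theta>" if \<omega>: "\<omega> \<in> space M" for \<omega>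
      proof (rule ccontr)
        assume ne: "u \<omega> \<noteq> \<theta>"
        then obtain j where j: "j < d" "u \<omega> $ j \<noteq> 0"
          using u(1)[OF \<omega> \<theta>d] unfolding \<theta>0 by (metis carrier_vecD eq_vecI index_zero_vec)
        have "l1_norm (u \<omega>) > 0"
          unfolding l1_norm_def using j u(1)[OF \<omega> \<theta>d] by (intro sum_pos2[of _ j]) auto
        then have "lasso_objective (X \<omega>) (X \<omega> *\<^sub>v \<theta> + \<xi> \<omega>) l (u \<omega>) = \<infinity>"
          by (simp add: lasso_objective_def l_top ennreal_top_mult)
        moreover have "lasso_objective (X \<omega>) (X \<omega> *\<^sub>v \<theta> + \<xi> \<omega>) l \<theta> < \<infinity>"
          by (simp add: lasso_objective_def l1_norm_def \<theta>0)
        ultimately show False using u(2)[OF \<omega> \<theta>d] by simp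
      qed
      then have "l2_norm (X \<omega> *\<^sub>v (u \<omega> - \<theta>)) = 0" if "\<omega> \<in> space M" for \<omega>
        using that \<theta>d design[OF that] by (auto simp: l2_norm_def)
      then show ?thesis by (simp only: ev) simp
    qed
    then show ?thesis using rhs0 by (simp only: measure_empty)
  next
    case (real N)
    define r where "r = 2 * L * N * sqrt (D / real n)"
    have r: "r \<ge> 0" using L real D by (simp add: r_def)
    have l: "l = ennreal r" using L real by (simp add: l_def r_def ennreal_mult' [symmetric])
    define bad where "bad = {\<omega> \<in> space M. \<exists>j<d. real n * (2 * L * N * sqrt (ln (real d) / real n))
                                         < 4 * \<bar>\<Sum>i<n. \<xi> \<omega> $ i * X \<omega> $$ (i, j)\<bar>}"
    have tail: "bad \<in> events" "prob bad \<le> 4 * (4 * K powr (1 / 4) + 3 * sqrt v) / L"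
      unfolding bad_def by (rule score_tail_bound[OF n d design iid mean indep v K \<alpha> real L]; assumption)+
    have sub: "?ev \<subseteq> bad \<union> (space M - good)"
    proof
      fix \<omega> assume "\<omega> \<in> ?ev"
      then have \<omega>: "\<omega> \<in> space M" and big: "ennreal (16 * L\<^sup>2) * (ennreal N)\<^sup>2 / ennreal (c\<^sup>2) *
            ennreal (real s * D / real n) < ennreal (1 / real n * (l2_norm (X \<omega> *\<^sub>v (u \<omega> - \<theta>)))\<^sup>2)"
        unfolding ev by (auto simp: real)
      show "\<omega> \<in> bad \<union> (space M - good)"
      proof (rule ccontr)
        assume not: "\<omega> \<notin> bad \<union> (space M - good)"
        let ?S = "{j. j < d \<and> \<theta> $ j \<noteq> 0}"
        let ?y = "X \<omega> *\<^sub>v \<theta> + \<xi> \<omega>"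
        have "1 / real n * (l2_norm (X \<omega> *\<^sub>v (u \<omega> - \<theta>)))\<^sup>2 \<le> 4 * r\<^sup>2 * real (card ?S) / c\<^sup>2"
        proof (rule lasso_prediction_error[OF design[OF \<omega>] \<theta>d u(1)[OF \<omega> \<theta>d] noise[OF \<omega>] n r c _ _ refl])
          have obj: "lasso_objective (X \<omega>) ?y l w
              = ennreal (1 / real n * (l2_norm (?y - X \<omega> *\<^sub>v w))\<^sup>2 + r * l1_norm w)" for w
            using design[OF \<omega>] r by (simp add: lasso_objective_def l ennreal_mult'[symmetric] l1_norm_def sum_nonneg)
          show "1 / real n * (l2_norm (?y - X \<omega> *\<^sub>v u \<omega>))\<^sup>2 + r * l1_norm (u \<omega>)
              \<le> 1 / real n * (l2_norm (?y - X \<omega> *\<^sub>v \<theta>))\<^sup>2 + r * l1_norm \<theta>"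
            using u(2)[OF \<omega> \<theta>d] r unfolding obj
            by (subst (asm) ennreal_le_iff) (auto simp: l1_norm_def intro!: add_nonneg_nonneg mult_nonneg_nonneg sum_nonneg)
          show "4 * \<bar>\<Sum>i<n. \<xi> \<omega> $ i * X \<omega> $$ (i, j)\<bar> \<le> real n * r" if "j < d" for j
          proof -
            have "\<not> real n * (2 * L * N * sqrt (ln (real d) / real n))
                < 4 * \<bar>\<Sum>i<n. \<xi> \<omega> $ i * X \<omega> $$ (i, j)\<bar>"
              using not \<omega> that unfolding bad_def by blast
            then show ?thesis by (simp only: r_def D_def not_less)
          qed
          assume "?S \<noteq> {}"
          moreover have "?S \<subseteq> {..<d}" by auto
          ultimately show "c \<le> compatibility (X \<omega>) 3 ?S" using not \<omega> card_S by (auto simp: good_def)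
        qed
        also have "\<dots> \<le> 4 * r\<^sup>2 * real s / c\<^sup>2"
          using card_S by (intro divide_right_mono mult_left_mono) auto
        also have "\<dots> = 16 * L\<^sup>2 * N\<^sup>2 / c\<^sup>2 * (real s * D / real n)"
          using D by (simp add: r_def power_mult_distrib mult_ac)
        finally have "ennreal (1 / real n * (l2_norm (X \<omega> *\<^sub>v (u \<omega> - \<theta>)))\<^sup>2)
            \<le> ennreal (16 * L\<^sup>2 * N\<^sup>2 / c\<^sup>2 * (real s * D / real n))" by (rule ennreal_leI)
        also have "\<dots> = ennreal (16 * L\<^sup>2) * (ennreal N)\<^sup>2 / ennreal (c\<^sup>2) * ennreal (real s * D / real n)"
          using real c D by (simp add: ennreal_mult'[symmetric] ennreal_mult''[symmetric] ennreal_power divide_ennreal)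
        finally show False using big by simp
      qed
    qed
    show ?thesis
    \<comment> \<open>An arbitrary selection of minimizers need not be measurable; a set outside the sigma-algebra
      has measure 0.\<close>
    proof (cases "?ev \<in> events")
      case False
      show ?thesis unfolding measure_notin_sets[OF False] by (rule rhs0)
    next
      case True
      have "prob ?ev \<le> prob (bad \<union> (space M - good))"
        using sub tail(1) good by (intro finite_measure_mono) auto
      also have "\<dots> \<le> prob bad + prob (space M - good)"
        using tail(1) good by (intro measure_Un_le) auto
      also have "prob (space M - good) = 1 - prob good" by (rule prob_compl[OF good])
      finally show ?thesis using tail(2) by linarith
    qed
  qed
qed

theorem theorem5:
  fixes M :: "nat \<Rightarrow> 'a measure"
    and d s :: "nat \<Rightarrow> nat"
    and X :: "nat \<Rightarrow> 'a \<Rightarrow> real mat"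
    and \<xi> :: "nat \<Rightarrow> 'a \<Rightarrow> real vec"
    and est :: "ennreal \<Rightarrow> real mat \<Rightarrow> real vec \<Rightarrow> real vec"
    and c\<^sub>0 \<alpha> :: real
  assumes prob: "\<And>n. prob_space (M n)"
    and dim: "\<And>n. d n \<ge> 2"
    and design: "\<And>n \<omega>. \<omega> \<in> space (M n) \<Longrightarrow> X n \<omega> \<in> carrier_mat n (d n)"
    and noise: "\<And>n \<omega>. \<omega> \<in> space (M n) \<Longrightarrow> \<xi> n \<omega> \<in> carrier_vec n"
    and rows_iid: "\<And>n. iid_rows (M n) n (d n) (X n)"
    and rows_mean: "\<And>n i j. i < n \<Longrightarrow> j < d n \<Longrightarrow> mean_zero (M n) (\<lambda>\<omega>. X n \<omega> $$ (i, j))"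
    and noise_mean: "\<And>n i. i < n \<Longrightarrow> mean_zero (M n) (\<lambda>\<omega>. \<xi> n \<omega> $ i)"
    and indep: "\<And>n. indep_design_noise (M n) n (d n) (X n) (\<xi> n)"
    and spectrum_lower:
      "0 < liminf (\<lambda>n. ereal (Min (singular_values (gram_mean (M n) n (d n) (X n)))))"
    and spectrum_upper:
      "limsup (\<lambda>n. ereal (Max (singular_values (gram_mean (M n) n (d n) (X n))))) < \<infinity>"
    and c0: "c\<^sub>0 > 0"
    and compat:
      "(\<lambda>n. \<P>(\<omega> in M n. \<forall>S. S \<subseteq> {..<d n} \<longrightarrow> S \<noteq> {} \<longrightarrow> card S \<le> s n \<longrightarrow>
                 compatibility (X n \<omega>) 3 S \<ge> c\<^sub>0)) \<longlonglongrightarrow> 1"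
    and alpha: "1 / 4 \<le> \<alpha>" "\<alpha> \<le> 1 / 2"
    and moments:
      "limsup (\<lambda>n. ennreal (ln (real (d n))) *
                 max (fourth_moment (M n) (d n) (X n)) (ennreal ((ln (real (d n)))\<^sup>2)) /
                 ennreal (real n powr (2 - 4 * \<alpha>))) < \<infinity>"
    and lasso: "lasso_estimator est"
  shows
    "((\<lambda>L. limsup (\<lambda>n. SUP \<theta>\<^sub>0 \<in> sparse_vecs (d n) (s n).
        ereal (\<P>(\<omega> in M n.
          ennreal (1 / real n *
            (l2_norm (X n \<omega> *\<^sub>v
              (est (ennreal (2 * L) * noise_norm (M n) n \<alpha> (\<xi> n) *
                      ennreal (sqrt (ln (real (d n)) / real n)))
                   (X n \<omega>) (X n \<omega> *\<^sub>v \<theta>\<^sub>0 + \<xi> n \<omega>) - \<theta>\<^sub>0)))\<^sup>2)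
          > ennreal (16 * L\<^sup>2) * (noise_norm (M n) n \<alpha> (\<xi> n))\<^sup>2 / ennreal (c\<^sub>0\<^sup>2) *
            ennreal (real (s n) * ln (real (d n)) / real n))))) \<longlongrightarrow> 0) at_top"
proof -
  define K' where "K' = enn2real (limsup (\<lambda>n. ennreal (ln (real (d n))) *
                 max (fourth_moment (M n) (d n) (X n)) (ennreal ((ln (real (d n)))\<^sup>2)) /
                 ennreal (real n powr (2 - 4 * \<alpha>))))"
  define K where "K = K' + 1"
  have K: "K > 0" unfolding K_def K'_def by (intro add_nonneg_pos) auto
  have "limsup (\<lambda>n. ennreal (ln (real (d n))) *
                 max (fourth_moment (M n) (d n) (X n)) (ennreal ((ln (real (d n)))\<^sup>2)) /
                 ennreal (real n powr (2 - 4 * \<alpha>))) = ennreal K'"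
    unfolding K'_def using moments by (intro ennreal_enn2real[symmetric]) (simp add: less_top)
  also have "\<dots> < ennreal K" unfolding K_def by (subst ennreal_less_iff) (auto simp: K'_def)
  finally have ev_K: "eventually (\<lambda>n. ennreal (ln (real (d n))) *
                 max (fourth_moment (M n) (d n) (X n)) (ennreal ((ln (real (d n)))\<^sup>2)) /
                 ennreal (real n powr (2 - 4 * \<alpha>)) < ennreal K) sequentially"
    by (rule Limsup_lessD)
  obtain v' where "limsup (\<lambda>n. ereal (Max (singular_values (gram_mean (M n) n (d n) (X n))))) < ereal v'"
    using ereal_dense2[OF spectrum_upper] by blast
  then have ev_v: "eventually (\<lambda>n. ereal (Max (singular_values (gram_mean (M n) n (d n) (X n)))) < ereal v') sequentially"
    by (rule Limsup_lessD)
  \<comment> \<open>The maximum with 1 only makes the variance bound positive.\<close>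
  define v where "v = max v' 1"
  have v: "v > 0" by (simp add: v_def)
  define good where "good n = {\<omega> \<in> space (M n). \<forall>S. S \<subseteq> {..<d n} \<longrightarrow> S \<noteq> {} \<longrightarrow> card S \<le> s n \<longrightarrow>
                 compatibility (X n \<omega>) 3 S \<ge> c\<^sub>0}" for n
  define g where "g n = measure (M n) (good n)" for n
  have g: "g \<longlonglongrightarrow> 1" unfolding g_def[abs_def] good_def by (rule compat)
  then have ev_g: "eventually (\<lambda>n. g n > 0) sequentially" by (rule order_tendstoD) simp
  define C where "C = 4 * (4 * K powr (1 / 4) + 3 * sqrt v)"
  define err where "err L n = (SUP \<theta>\<^sub>0 \<in> sparse_vecs (d n) (s n).
        ereal (\<P>(\<omega> in M n.
          ennreal (1 / real n *
            (l2_norm (X n \<omega> *\<^sub>v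
              (est (ennreal (2 * L) * noise_norm (M n) n \<alpha> (\<xi> n) *
                      ennreal (sqrt (ln (real (d n)) / real n)))
                   (X n \<omega>) (X n \<omega> *\<^sub>v \<theta>\<^sub>0 + \<xi> n \<omega>) - \<theta>\<^sub>0)))\<^sup>2)
          > ennreal (16 * L\<^sup>2) * (noise_norm (M n) n \<alpha> (\<xi> n))\<^sup>2 / ennreal (c\<^sub>0\<^sup>2) *
            ennreal (real (s n) * ln (real (d n)) / real n))))" for L n
  have upper: "limsup (err L) \<le> ereal (C / L)" if L: "L > 0" for L
  proof -
    have "eventually (\<lambda>n. err L n \<le> ereal (C / L + (1 - g n))) sequentially"
      using ev_K ev_v ev_g eventually_gt_at_top[of 0]
    proof eventually_elim
      case (elim n)
      interpret prob_space "M n" by (rule prob)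
      have D: "ln (real (d n)) > 0" using dim[of n] by simp
      have p: "real n powr (2 - 4 * \<alpha>) > 0" using elim(4) by simp
      have "fourth_moment (M n) (d n) (X n) \<le> ennreal (K * real n powr (2 - 4 * \<alpha>) / ln (real (d n)))"
      proof -
        let ?F = "fourth_moment (M n) (d n) (X n)"
        have "ennreal (ln (real (d n))) * ?F / ennreal (real n powr (2 - 4 * \<alpha>)) \<le> ennreal K"
          by (rule order_trans[OF _ less_imp_le[OF elim(1)]]) (intro divide_right_mono_ennreal mult_left_mono; simp)
        then have "ennreal (ln (real (d n))) * ?F / ennreal (real n powr (2 - 4 * \<alpha>)) * ennreal (real n powr (2 - 4 * \<alpha>))
            \<le> ennreal K * ennreal (real n powr (2 - 4 * \<alpha>))" by (intro mult_right_mono) auto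
        also have "ennreal (ln (real (d n))) * ?F / ennreal (real n powr (2 - 4 * \<alpha>)) * ennreal (real n powr (2 - 4 * \<alpha>))
            = ennreal (ln (real (d n))) * ?F"
          using p by (simp add: ennreal_divide_times ennreal_divide_self)
        also have "ennreal K * ennreal (real n powr (2 - 4 * \<alpha>)) = ennreal (K * real n powr (2 - 4 * \<alpha>))"
          using K by (simp add: ennreal_mult')
        finally have "ennreal (1 / ln (real (d n))) * (ennreal (ln (real (d n))) * ?F)
            \<le> ennreal (1 / ln (real (d n))) * ennreal (K * real n powr (2 - 4 * \<alpha>))"
          by (intro mult_left_mono) auto
        then show ?thesis using D K
          by (simp add: ennreal_mult'[symmetric] mult.assoc[symmetric])
      qed
      moreover have "Max (singular_values (gram_mean (M n) n (d n) (X n))) \<le> v" using elim(2) by (simp add: v_def)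
      \<comment> \<open>A positive measure forces the set to be measurable.\<close>
      moreover have "good n \<in> events" using elim(3) measure_notin_sets[of "good n" "M n"] unfolding g_def by force
      ultimately show ?case unfolding err_def C_def g_def good_def
        by (intro SUP_least ereal_less_eq(3)[THEN iffD2]
          lasso_error_probability[OF elim(4) dim design noise rows_iid rows_mean indep v _ K _ alpha c0 L lasso])
    qed
    then have "limsup (err L) \<le> limsup (\<lambda>n. ereal (C / L + (1 - g n)))" by (rule Limsup_mono)
    also have "\<dots> = ereal (C / L + (1 - 1))"
      by (intro lim_imp_Limsup tendsto_intros g) auto
    finally show ?thesis by simp
  qed
  have lower: "0 \<le> limsup (err L)" for L
  proof -
    have "0 \<le> err L n" for n
    proof -
      have "{j. j < d n \<and> 0\<^sub>v (d n) $ j \<noteq> (0 :: real)} = {}" by auto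
      then have "0\<^sub>v (d n) \<in> sparse_vecs (d n) (s n)"
        unfolding sparse_vecs_def by (simp only: mem_Collect_eq card.empty zero_carrier_vec le0)
      then show ?thesis unfolding err_def by (rule SUP_upper2) simp
    qed
    then have "limsup (\<lambda>n. 0) \<le> limsup (err L)" by (intro Limsup_mono) auto
    then show ?thesis by (simp add: Limsup_const)
  qed
  have "((\<lambda>L. C / L) \<longlongrightarrow> 0) at_top"
    by (intro tendsto_divide_0[OF tendsto_const] filterlim_at_top_imp_at_infinity filterlim_ident)
  then have "((\<lambda>L. ereal (C / L)) \<longlongrightarrow> 0) at_top" by (simp add: zero_ereal_def)
  then have "((\<lambda>L. limsup (err L)) \<longlongrightarrow> 0) at_top"
    by (rule tendsto_sandwich[OF _ _ tendsto_const, rotated 2])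
      (auto simp: lower intro: eventually_mono[OF eventually_gt_at_top[of 0] upper])
  then show ?thesis unfolding err_def[abs_def] .
qed

end
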